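(* Let $A$ be a unital separable simple $C^*$-algebra with $TR(A)=0$ and let $x,y\in A$ be two normal elements. Then $$\mathrm{dist}(\mathcal U(x),\mathcal U(y))\ge d_T(x,y).$$ If $A$ is (instead) a finite dimensional $C^*$-algebra and $x,y\in A$ are two normal elements, then $$\mathrm{dist}(\mathcal U(x),\mathcal U(y))\ge d_c(x,y).$$
   Context: A unital simple $C^*$-algebra $A$ has tracial rank zero, $TR(A)=0$, if for every finite $\mathcal F\subset A$, $\epsilon>0$ and non-zero $a\in A_+$ there are a projection $p\in A$ and a finite dimensional $C^*$-subalgebra $B\subset A$ with $1_B=p$ such that $\|pc-cp\|<\epsilon$ and $\mathrm{dist}(pcp,B)<\epsilon$ for all $c\in\mathcal F$, and $1-p$ is Murray–von Neumann equivalent to a projection in $\overline{aAa}$. $T(A)$ is the tracial state space of $A$. For a normal element $x$, $\mathcal U(x)$ is the norm closure of $\{u^*xu:u\in A\text{ unitary}\}$, and $\mathrm{dist}(\mathcal U(x),\mathcal U(y))=\inf\{\|a-b\|:a\in\mathcal U(x),\,b\in\mathcal U(y)\}$. For positive $a,b\in A$, $a\lesssim b$ means there is a sequence $\{x_n\}\subset A$ with $x_n^*bx_n\to a$. For $b\in A_+$ and $\tau\in T(A)$, $d_\tau(b)=\lim_{\epsilon\to0}\tau(f_\epsilon(b))$, where $f_\epsilon$ is continuous on $[0,\infty)$, $f_\epsilon=1$ on $[\epsilon,\infty)$, $f_\epsilon=0$ on $[0,\epsilon/2]$, linear on $(\epsilon/2,\epsilon)$. Let $\Omega=\mathrm{sp}(x)\cup\mathrm{sp}(y)\subset\mathbb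 C$. For $\lambda\in\mathbb C$ and $s>0$ let $O(\lambda,s)$ be the open disc in $\mathbb C$ with center $\lambda$ and radius $s$; for an open $O\subset\mathbb C$, $f_O\in C(\Omega)$ denotes any function with $0\le f_O\le1$ that is positive exactly on $O\cap\Omega$. Put $$\delta_T(x,y)=\inf\{r>0:d_\tau(f_{O(\lambda,s)}(x))\le d_\tau(f_{O(\lambda,s+r)}(y))\text{ for all }\lambda\in\mathbb C,\ s>0,\ \tau\in T(A)\},$$ $$\delta_c(x,y)=\inf\{r>0:f_{O(\lambda,s)}(x)\lesssim f_{O(\lambda,s+r)}(y)\text{ for all }\lambda\in\mathbb C,\ s>0\},$$ $d_T(x,y)=\max\{\delta_T(x,y),\delta_T(y,x)\}$ and $d_c(x,y)=\max\{\delta_c(x,y),\delta_c(y,x)\}$. *)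

theory Defs
  imports "HOL-Analysis.Analysis"
begin

section \<open>Unital $C^*$-algebras\<close>

text \<open>
  The algebra is a type.  The real scalar multiplication comes with the superclass
  and is tied to the complex one by \<open>cscale_of_real\<close>.  The superclass
  contains \<open>norm 1 = 1\<close>, so the algebra is non-zero.
\<close>

class unital_cstar_algebra = real_normed_algebra_1 + banach +
  fixes cscale :: "complex \<Rightarrow> 'a \<Rightarrow> 'a" (infixr "*\<^sub>c" 75)
    and adj :: "'a \<Rightarrow> 'a"
  assumes cscale_add_right: "c *\<^sub>c (a + b) = c *\<^sub>c a + c *\<^sub>c b"
    and cscale_add_left: "(c + d) *\<^sub>c a = c *\<^sub>c a + d *\<^sub>c a"
    and cscale_cscale: "c *\<^sub>c d *\<^sub>c a = (c * d) *\<^sub>c a"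
    and cscale_of_real: "complex_of_real r *\<^sub>c a = r *\<^sub>R a"
    and mult_cscale_left: "(c *\<^sub>c a) * b = c *\<^sub>c (a * b)"
    and mult_cscale_right: "a * (c *\<^sub>c b) = c *\<^sub>c (a * b)"
    and norm_cscale: "norm (c *\<^sub>c a) = cmod c * norm a"
    and adj_add: "adj (a + b) = adj a + adj b"
    and adj_cscale: "adj (c *\<^sub>c a) = cnj c *\<^sub>c adj a"
    and adj_mult: "adj (a * b) = adj b * adj a"
    and adj_adj: "adj (adj a) = a"
    and cstar_identity: "norm (adj a * a) = (norm a)\<^sup>2"

lemma cscale_one: "1 *\<^sub>c (a :: 'a::unital_cstar_algebra) = a"
  using cscale_of_real[of 1 a] by simp

global_interpretation cvec: vector_space "cscale :: complex \<Rightarrow> 'a \<Rightarrow> 'a::unital_cstar_algebra"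
  by unfold_locales
    (simp_all add: cscale_add_right cscale_add_left cscale_cscale cscale_one)

definition normal_element :: "'a::unital_cstar_algebra \<Rightarrow> bool" where
  "normal_element x \<longleftrightarrow> adj x * x = x * adj x"

definition unitary_element :: "'a::unital_cstar_algebra \<Rightarrow> bool" where
  "unitary_element u \<longleftrightarrow> adj u * u = 1 \<and> u * adj u = 1"

definition projection :: "'a::unital_cstar_algebra \<Rightarrow> bool" where
  "projection p \<longleftrightarrow> adj p = p \<and> p * p = p"

definition invertible_element :: "'a::unital_cstar_algebra \<Rightarrow> bool" where
  "invertible_element a \<longleftrightarrow> (\<exists>b. a * b = 1 \<and> b * a = 1)"

definition spectrum :: "'a::unital_cstar_algebra \<Rightarrow> complex set" where
  "spectrum a = {\<mu>. \<not> invertible_element (\<mu> *\<^sub>c 1 - a)}"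

definition positive_element :: "'a::unital_cstar_algebra \<Rightarrow> bool" where
  "positive_element a \<longleftrightarrow> adj a = a \<and> spectrum a \<subseteq> \<real>\<^sub>\<ge>\<^sub>0"

definition mvn_equiv :: "'a::unital_cstar_algebra \<Rightarrow> 'a \<Rightarrow> bool" where
  "mvn_equiv p q \<longleftrightarrow> (\<exists>v. adj v * v = p \<and> v * adj v = q)"

definition unitary_orbit :: "'a::unital_cstar_algebra \<Rightarrow> 'a set" where
  "unitary_orbit x = closure {adj u * x * u | u. unitary_element u}"


section \<open>Simplicity, finite dimension, tracial rank zero\<close>

definition closed_ideal :: "'a::unital_cstar_algebra set \<Rightarrow> bool" where
  "closed_ideal I \<longleftrightarrow>
     closed I \<and> cvec.subspace I \<and> (\<forall>a. \<forall>b\<in>I. a * b \<in> I \<and> b * a \<in> I)"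

definition simple_algebra :: "'a::unital_cstar_algebra itself \<Rightarrow> bool" where
  "simple_algebra TYPE('a) \<longleftrightarrow>
     (\<forall>I :: 'a set. closed_ideal I \<longrightarrow> I = {0} \<or> I = UNIV)"

definition separable_algebra :: "'a::unital_cstar_algebra itself \<Rightarrow> bool" where
  "separable_algebra TYPE('a) \<longleftrightarrow> separable_space (euclidean :: 'a topology)"

definition finite_dimensional :: "'a::unital_cstar_algebra set \<Rightarrow> bool" where
  "finite_dimensional V \<longleftrightarrow> (\<exists>S. finite S \<and> V = cvec.span S)"

definition cstar_subalgebra :: "'a::unital_cstar_algebra set \<Rightarrow> bool" where
  "cstar_subalgebra B \<longleftrightarrow>
     closed B \<and> cvec.subspace B \<and> (\<forall>a\<in>B. adj a \<in> B) \<and> (\<forall>a\<in>B. \<forall>b\<in>B. a * b \<in> B)"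

definition is_unit_of :: "'a::unital_cstar_algebra \<Rightarrow> 'a set \<Rightarrow> bool" where
  "is_unit_of p B \<longleftrightarrow> p \<in> B \<and> (\<forall>b\<in>B. p * b = b \<and> b * p = b)"

definition hereditary_subalgebra :: "'a::unital_cstar_algebra \<Rightarrow> 'a set" where
  "hereditary_subalgebra a = closure (range (\<lambda>z. a * z * a))"

definition tracial_rank_zero :: "'a::unital_cstar_algebra itself \<Rightarrow> bool" where
  "tracial_rank_zero TYPE('a) \<longleftrightarrow>
     (\<forall>(F :: 'a set) (\<epsilon> :: real) (a :: 'a).
        finite F \<and> 0 < \<epsilon> \<and> positive_element a \<and> a \<noteq> 0 \<longrightarrow>
        (\<exists>p B. projection p \<and> cstar_subalgebra B \<and> finite_dimensional B \<and> is_unit_of p B \<and>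
           (\<forall>c\<in>F. norm (p * c - c * p) < \<epsilon> \<and> infdist (p * c * p) B < \<epsilon>) \<and>
           (\<exists>q. projection q \<and> q \<in> hereditary_subalgebra a \<and> mvn_equiv (1 - p) q)))"


section \<open>Continuous functional calculus\<close>

text \<open>
  A unital $*$-homomorphism from $C(\mathrm{sp}(x))$ that maps the inclusion of
  $\mathrm{sp}(x)$ in the complex plane to $x$.  Elements of $C(\mathrm{sp}(x))$ are
  represented by total functions that are continuous on the spectrum; the first
  condition says that only their values there matter.
\<close>

definition functional_calculus ::
  "'a::unital_cstar_algebra \<Rightarrow> ((complex \<Rightarrow> complex) \<Rightarrow> 'a) \<Rightarrow> bool" where
  "functional_calculus x \<Phi> \<longleftrightarrow>
     (\<forall>f g. (\<forall>z\<in>spectrum x. f z = g z) \<longrightarrow> \<Phi> f = \<Phi> g) \<and>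
     (\<forall>f g. continuous_on (spectrum x) f \<and> continuous_on (spectrum x) g \<longrightarrow>
        \<Phi> (\<lambda>z. f z + g z) = \<Phi> f + \<Phi> g \<and> \<Phi> (\<lambda>z. f z * g z) = \<Phi> f * \<Phi> g) \<and>
     (\<forall>c f. continuous_on (spectrum x) f \<longrightarrow>
        \<Phi> (\<lambda>z. c * f z) = c *\<^sub>c \<Phi> f \<and> \<Phi> (\<lambda>z. cnj (f z)) = adj (\<Phi> f)) \<and>
     \<Phi> (\<lambda>z. 1) = 1 \<and> \<Phi> (\<lambda>z. z) = x"

text \<open>
  For normal \<open>x\<close> such a homomorphism exists and is unique on $C(\mathrm{sp}(x))$, so
  the choice below matters only for functions that are not continuous on the spectrum.
\<close>

definition cfc :: "'a::unital_cstar_algebra \<Rightarrow> (complex \<Rightarrow> complex) \<Rightarrow> 'a" where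
  "cfc x = (SOME \<Phi>. functional_calculus x \<Phi>)"

abbreviation cfc_real :: "'a::unital_cstar_algebra \<Rightarrow> (complex \<Rightarrow> real) \<Rightarrow> 'a" where
  "cfc_real x f \<equiv> cfc x (\<lambda>z. complex_of_real (f z))"


section \<open>Cuntz comparison and tracial states\<close>

definition cuntz_le :: "'a::unital_cstar_algebra \<Rightarrow> 'a \<Rightarrow> bool" (infix "\<lesssim>" 50) where
  "a \<lesssim> b \<longleftrightarrow> (\<exists>X :: nat \<Rightarrow> 'a. (\<lambda>n. adj (X n) * b * X n) \<longlonglongrightarrow> a)"

definition tracial_states :: "('a::unital_cstar_algebra \<Rightarrow> complex) set" where
  "tracial_states = {\<tau>. Vector_Spaces.linear (*\<^sub>c) (*) \<tau> \<and>
     (\<forall>a. positive_element a \<longrightarrow> \<tau> a \<in> \<real>\<^sub>\<ge>\<^sub>0) \<and> \<tau> 1 = 1 \<and> (\<forall>a b. \<tau> (a * b) = \<tau> (b * a))}"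

definition f_eps :: "real \<Rightarrow> real \<Rightarrow> real" where
  "f_eps \<epsilon> t = (if t \<le> \<epsilon> / 2 then 0 else if \<epsilon> \<le> t then 1 else 2 * t / \<epsilon> - 1)"

text \<open>
  For positive \<open>b\<close> the spectrum consists of non-negative reals, and
  $\tau(f_\epsilon(b))$ is real.
\<close>

definition d_tau :: "('a::unital_cstar_algebra \<Rightarrow> complex) \<Rightarrow> 'a \<Rightarrow> real" where
  "d_tau \<tau> b = Lim (at_right 0) (\<lambda>\<epsilon>. Re (\<tau> (cfc_real b (\<lambda>z. f_eps \<epsilon> (Re z)))))"


section \<open>The distances\<close>

text \<open>
  The functions that may serve as $f_O$.  The distances below quantify over all of
  them, since $d_\tau(f_O(x))$ and the Cuntz class of $f_O(x)$ do not depend on which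
  one is taken.
\<close>

definition disc_functions :: "complex set \<Rightarrow> complex set \<Rightarrow> (complex \<Rightarrow> real) set" where
  "disc_functions \<Omega> O' = {f. continuous_on \<Omega> f \<and>
     (\<forall>z\<in>\<Omega>. 0 \<le> f z \<and> f z \<le> 1 \<and> (0 < f z \<longleftrightarrow> z \<in> O'))}"

definition delta_T :: "'a::unital_cstar_algebra \<Rightarrow> 'a \<Rightarrow> real" where
  "delta_T x y = (let \<Omega> = spectrum x \<union> spectrum y in
     Inf {r. 0 < r \<and> (\<forall>\<mu> s. \<forall>\<tau>\<in>tracial_states. 0 < s \<longrightarrow>
       (\<forall>f\<in>disc_functions \<Omega> (ball \<mu> s). \<forall>g\<in>disc_functions \<Omega> (ball \<mu> (s + r)).
          d_tau \<tau> (cfc_real x f) \<le> d_tau \<tau> (cfc_real y g)))})"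

definition delta_c :: "'a::unital_cstar_algebra \<Rightarrow> 'a \<Rightarrow> real" where
  "delta_c x y = (let \<Omega> = spectrum x \<union> spectrum y in
     Inf {r. 0 < r \<and> (\<forall>\<mu> s. 0 < s \<longrightarrow>
       (\<forall>f\<in>disc_functions \<Omega> (ball \<mu> s). \<forall>g\<in>disc_functions \<Omega> (ball \<mu> (s + r)).
          cfc_real x f \<lesssim> cfc_real y g))})"

definition d_T :: "'a::unital_cstar_algebra \<Rightarrow> 'a \<Rightarrow> real" where
  "d_T x y = max (delta_T x y) (delta_T y x)"

definition d_c :: "'a::unital_cstar_algebra \<Rightarrow> 'a \<Rightarrow> real" where
  "d_c x y = max (delta_c x y) (delta_c y x)"

end

theory Submission
  imports Defs
begin

text \<open>
  Let \<open>r\<close> exceed the distance of the orbits.  There is a unitary \<open>w\<close> with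
  \<open>\<parallel>x - w\<^sup>*yw\<parallel> \<le> r\<close>, and it suffices to compare, for every disc, the functions \<open>f(x)\<close> and
  \<open>g(y)\<close> of \<open>x\<close> and \<open>y\<close> that live on the concentric discs with centre \<open>\<mu>\<close> and radii
  \<open>s\<close> and \<open>s + r\<close>.  If \<open>x\<close> and \<open>y\<close> act on a Hilbert space, a vector \<open>\<xi>\<close>
  with \<open>\<parallel>(x - \<mu>)\<xi>\<parallel> < s\<parallel>\<xi>\<parallel>\<close> satisfies \<open>\<parallel>(w\<^sup>*yw - \<mu>)\<xi>\<parallel> < (s + r)\<parallel>\<xi>\<parallel>\<close>.
  The form of this remark inside the algebra is the operator inequality
  \<open>(s + r)\<^sup>2 - |w\<^sup>*yw - \<mu>|\<^sup>2 \<ge> (s + r)/s \<cdot> (s\<^sup>2 - |x - \<mu>|\<^sup>2)\<close>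
  (\<open>disc_operator_inequality\<close>), which is a completed square.  Let \<open>\<phi>\<close> and \<open>\<psi>\<close> be the
  positive parts of \<open>s\<^sup>2 - |z - \<mu>|\<^sup>2\<close> and \<open>(s + r)\<^sup>2 - |z - \<mu>|\<^sup>2\<close>.  Replacing the left side by
  \<open>w\<^sup>*\<psi>(y)w\<close> and multiplying from both sides by \<open>\<phi>(x)\<^sup>1\<^sup>/\<^sup>2\<close> gives
  \<open>(s + r)/s \<cdot> \<phi>(x)\<^sup>2 \<le> X\<^sup>*X\<close> with \<open>X = \<psi>(y)\<^sup>1\<^sup>/\<^sup>2w\<phi>(x)\<^sup>1\<^sup>/\<^sup>2\<close>, while
  \<open>XX\<^sup>* \<le> s\<^sup>2\<psi>(y)\<close> (\<open>disc_comparison\<close>).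

  Both comparisons now follow from general principles (\<open>disc_function_comparison\<close>).  For Cuntz
  comparison: \<open>0 \<le> a \<le> b\<close> implies \<open>a \<lesssim> b\<close>, and functions of one normal element compare
  as soon as the open supports are contained in each other.  For \<open>d\<^sub>\<tau>\<close>: it is the supremum of
  \<open>\<tau>(b(b + \<kappa>)\<^sup>-\<^sup>1)\<close> over \<open>\<kappa> > 0\<close>; these elements increase with \<open>b\<close>, and the trace
  takes the same value at \<open>b = X\<^sup>*X\<close> and at \<open>b = XX\<^sup>*\<close>.  Hence
  \<open>d\<^sub>\<tau>(f(x)) \<le> d\<^sub>\<tau>(X\<^sup>*X) \<le> d\<^sub>\<tau>(XX\<^sup>*) \<le> d\<^sub>\<tau>(g(y))\<close>.

  The continuous functional calculus has to be constructed first.  Non-negative elements are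
  the squares of self-adjoint elements, and a binomial series makes this equivalent to a norm
  condition that is obviously stable under sums.  In the bicommutant of
  a normal element the self-adjoint elements therefore form an archimedean ordered real algebra;
  a maximal ordering of it, found by Zorn's lemma, determines a character.  The obstructions to
  enlarging the ordering by a given element are certificates of the form \<open>-1 = p + qa\<close>, and
  ruling them out gives both the norm formula and the description of the spectrum by
  characters.  The theorem of Stone and Weierstrass completes the construction
  (\<open>functional_calculus_cfc\<close>).
\<close>


section \<open>The involution\<close>

lemma adj_zero [simp]: "adj (0::'a::unital_cstar_algebra) = 0"
  using adj_add[of "0::'a" 0] by simp

lemma adj_minus [simp]: "adj (- a) = - adj (a::'a::unital_cstar_algebra)"
  using adj_add[of a "- a"] by (simp add: eq_neg_iff_add_eq_0 add.commute)

lemma adj_diff [simp]: "adj (a - b) = adj a - adj (b::'a::unital_cstar_algebra)"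
  using adj_add[of a "- b"] by simp

lemma adj_one [simp]: "adj (1::'a::unital_cstar_algebra) = 1"
  using adj_mult[of "adj 1" "1::'a"] by (simp add: adj_adj)

lemma adj_scaleR [simp]: "adj (r *\<^sub>R a) = r *\<^sub>R adj (a::'a::unital_cstar_algebra)"
  using adj_cscale[of "complex_of_real r" a] by (simp add: cscale_of_real)

lemma adj_of_real [simp]: "adj (of_real r :: 'a::unital_cstar_algebra) = of_real r"
  by (simp add: of_real_def)

declare adj_adj [simp] adj_add [simp]

lemma norm_adj [simp]: "norm (adj a) = norm (a::'a::unital_cstar_algebra)"
proof -
  have le: "norm b \<le> norm (adj b)" for b :: 'a
  proof (cases "b = 0")
    case False
    have "norm b * norm b \<le> norm (adj b) * norm b"
      using norm_mult_ineq[of "adj b" b] by (simp add: cstar_identity power2_eq_square)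
    with False show ?thesis by simp
  qed simp
  show ?thesis using le[of a] le[of "adj a"] by simp
qed

lemma norm_sq: "norm (a * adj a) = (norm (a::'a::unital_cstar_algebra))\<^sup>2"
  using cstar_identity[of "adj a"] by simp

lemma bounded_linear_adj: "bounded_linear (adj :: 'a \<Rightarrow> 'a::unital_cstar_algebra)"
  by (intro bounded_linear_intro[where K = 1]) simp_all

lemma adj_power: "adj (a ^ n) = adj (a::'a::unital_cstar_algebra) ^ n"
  by (induction n) (simp_all add: adj_mult power_commutes)

lemma of_real_central: "of_real r * a = a * (of_real r :: 'a::real_algebra_1)"
  by (simp add: of_real_def)

definition commutant :: "'a::monoid_mult set \<Rightarrow> 'a set" where
  "commutant S = {a. \<forall>s\<in>S. a * s = s * a}"

section \<open>Square roots of self-adjoint elements\<close>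

text \<open>
  These are the coefficients of the power series of \<open>\<surd>(1 - t)\<close> at \<open>0\<close>.  All of them but the
  first are non-positive and the partial sums stay non-negative, so the series converges
  absolutely even at \<open>t = 1\<close>; the convolution is Vandermonde's identity.
\<close>

lemma half_choose_alternating:
  fixes c :: "nat \<Rightarrow> real"
  defines "c \<equiv> \<lambda>n. (1/2 gchoose n) * (-1) ^ n"
  shows summable_half_choose: "summable (\<lambda>n. \<bar>c n\<bar>)"
    and half_choose_convolution:
      "(\<Sum>i\<le>k. c i * c (k - i)) = (if k = 0 then 1 else if k = 1 then -1 else 0)"
proof -
  have c: "c n = pochhammer (-1/2) n / fact n" for n
    by (simp add: c_def gbinomial_pochhammer power_mult_distrib[symmetric])
  have neg: "c (Suc n) \<le> 0" for n
  proof -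
    have "pochhammer (1/2::real) n \<ge> 0" by (simp add: pochhammer_nonneg)
    then show ?thesis by (simp add: c pochhammer_rec divide_nonpos_nonneg)
  qed
  have "sum c {..m} = (-1) ^ m * ((1/2 - 1 :: real) gchoose m)" for m
    unfolding c_def by (rule gbinomial_sum_lower_neg)
  also have "\<dots>m = pochhammer (1/2) m / fact m" for m
    by (simp add: gbinomial_pochhammer)
  finally have pos: "sum c {..m} \<ge> 0" for m
    by (simp add: pochhammer_nonneg)
  \<comment> \<open>Only the leading coefficient, which is \<open>1\<close>, is positive.\<close>
  have abs: "(\<Sum>n\<le>m. \<bar>c n\<bar>) = 2 - sum c {..m}" for m
  proof (induction m)
    case (Suc m)
    then show ?case using neg[of m] by simp
  qed (simp add: c)
  show "summable (\<lambda>n. \<bar>c n\<bar>)"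
  proof (rule summableI_nonneg_bounded)
    show "sum (\<lambda>n. \<bar>c n\<bar>) {..<n} \<le> 2" for n
      using abs[of n] pos[of n] by (simp add: lessThan_Suc_atMost[symmetric])
  qed simp
  have "(\<Sum>i\<le>k. c i * c (k - i)) = (\<Sum>i\<le>k. (1/2 gchoose i) * (1/2 gchoose (k - i))) * (-1) ^ k"
    by (auto simp: c_def sum_distrib_right power_add[symmetric] mult.assoc mult.left_commute intro!: sum.cong)
  also have "\<dots> = ((1 :: real) gchoose k) * (-1) ^ k"
    using gbinomial_Vandermonde[of "1/2::real" "1/2" k] by (simp add: atLeast0AtMost)
  also have "\<dots> = (if k = 0 then 1 else if k = 1 then -1 else 0)"
    using binomial_gbinomial[of 1 k, where ?'a = real] by (auto simp: binomial_eq_0)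
  finally show "(\<Sum>i\<le>k. c i * c (k - i)) = (if k = 0 then 1 else if k = 1 then -1 else 0)" .
qed

text \<open>
  The binomial series for the exponent \<open>1/2\<close> converges on the closed unit ball.  Since the root is a
  limit of polynomials in \<open>y\<close>, it lies in the bicommutant of \<open>y\<close>; this is how commutation
  relations pass to square roots.
\<close>

lemma sqrt_one_minus:
  fixes y :: "'a::unital_cstar_algebra"
  assumes y: "adj y = y" "norm y \<le> 1"
  obtains z where "adj z = z" "z * z = 1 - y" "z \<in> commutant (commutant {y})"
proof -
  define c :: "nat \<Rightarrow> real" where "c = (\<lambda>n. (1/2 gchoose n) * (-1) ^ n)"
  define z where "z = (\<Sum>n. c n *\<^sub>R y ^ n)"
  have sn: "summable (\<lambda>n. norm (c n *\<^sub>R y ^ n))"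
  proof (rule summable_comparison_test')
    show "summable (\<lambda>n. \<bar>c n\<bar>)" unfolding c_def by (rule summable_half_choose)
    have "norm (y ^ n) \<le> 1" for n
      using order_trans[OF norm_power_ineq power_le_one[OF norm_ge_zero y(2)]] .
    then show "norm (norm (c n *\<^sub>R y ^ n)) \<le> \<bar>c n\<bar>" if "n \<ge> 0" for n
      by (simp add: mult_left_le)
  qed
  then have s: "summable (\<lambda>n. c n *\<^sub>R y ^ n)" by (rule summable_norm_cancel)
  have conv: "(\<Sum>i\<le>k. c i * c (k - i)) = (if k = 0 then 1 else if k = 1 then -1 else 0)" for k
    unfolding c_def by (rule half_choose_convolution)
  have "(\<Sum>i\<le>k. (c i *\<^sub>R y ^ i) * (c (k - i) *\<^sub>R y ^ (k - i))) =
      (if k = 0 then 1 else if k = 1 then - y else 0)" for k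
  proof -
    have "(\<Sum>i\<le>k. (c i *\<^sub>R y ^ i) * (c (k - i) *\<^sub>R y ^ (k - i))) = (\<Sum>i\<le>k. (c i * c (k - i)) *\<^sub>R y ^ k)"
      by (intro sum.cong) (auto simp: power_add[symmetric])
    also have "\<dots> = (\<Sum>i\<le>k. c i * c (k - i)) *\<^sub>R y ^ k" by (simp add: scaleR_sum_left)
    finally show ?thesis by (simp add: conv)
  qed
  then have "(\<lambda>k. if k = 0 then 1 else if k = 1 then - y else 0) sums (z * z)"
    using Cauchy_product_sums[OF sn sn] by (simp add: z_def)
  moreover have "(\<lambda>k. if k = 0 then 1 else if k = 1 then - y else 0) sums
      (\<Sum>k\<in>{0, 1::nat}. if k = 0 then 1 else if k = 1 then - y else 0)"
    by (rule sums_finite) auto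
  ultimately have "z * z = 1 - y" using sums_unique2 by fastforce
  moreover have "adj z = z"
    using bounded_linear.suminf[OF bounded_linear_adj s] by (simp add: z_def adj_power y)
  moreover have "z \<in> commutant (commutant {y})"
  proof -
    have "z * b = b * z" if "b * y = y * b" for b
    proof -
      have "b * y ^ n = y ^ n * b" for n
        using that by (simp add: power_commuting_commutes)
      then have "(\<Sum>n. c n *\<^sub>R y ^ n * b) = (\<Sum>n. b * (c n *\<^sub>R y ^ n))"
        by simp
      then show ?thesis
        unfolding z_def suminf_mult[OF s] suminf_mult2[OF s] by simp
    qed
    then show ?thesis by (auto simp: commutant_def)
  qed
  ultimately show thesis using that by blast
qed

section \<open>The cone of non-negative elements\<close>

text \<open>
  For a self-adjoint \<open>a\<close> the condition says that the spectrum lies in an interval \<open>[0, 2t]\<close>.  In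
  this form the cone is stable under sums by the triangle inequality, and
  \<open>1 - a/t\<close> lies in the unit ball, where square roots are available.  It describes the
  positive elements (\<open>positive_element_iff_nonneg\<close>).
\<close>

definition nonneg :: "'a::unital_cstar_algebra \<Rightarrow> bool" where
  "nonneg a \<longleftrightarrow> adj a = a \<and> (\<exists>t\<ge>0. norm (of_real t - a) \<le> t)"

lemma nonneg_adj: "nonneg a \<Longrightarrow> adj a = a"
  by (simp add: nonneg_def)

lemma nonneg_of_real [simp]: "r \<ge> 0 \<Longrightarrow> nonneg (of_real r :: 'a::unital_cstar_algebra)"
  by (auto simp: nonneg_def intro!: exI[of _ r])

lemma nonneg_zero [simp]: "nonneg (0::'a::unital_cstar_algebra)"
  and nonneg_one [simp]: "nonneg (1::'a::unital_cstar_algebra)"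
  using nonneg_of_real[of 0] nonneg_of_real[of 1] by simp_all

lemma nonneg_add:
  assumes "nonneg a" "nonneg b"
  shows "nonneg (a + b)"
proof -
  obtain s t where st: "s \<ge> 0" "norm (of_real s - a) \<le> s" "t \<ge> 0" "norm (of_real t - b) \<le> t"
    using assms by (auto simp: nonneg_def)
  have "norm (of_real (s + t) - (a + b)) = norm ((of_real s - a) + (of_real t - b))"
    by (simp add: algebra_simps)
  also have "\<dots> \<le> s + t"
    using norm_triangle_ineq[of "of_real s - a" "of_real t - b"] st by linarith
  finally show ?thesis
    using assms st by (auto simp: nonneg_def intro!: exI[of _ "s + t"])
qed

lemma nonneg_scaleR:
  assumes "nonneg a" "r \<ge> 0"
  shows "nonneg (r *\<^sub>R a)"
proof -
  obtain s where s: "s \<ge> 0" "norm (of_real s - a) \<le> s"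
    using assms by (auto simp: nonneg_def)
  have "norm (of_real (r * s) - r *\<^sub>R a) = norm (r *\<^sub>R (of_real s - a))"
    by (simp add: algebra_simps of_real_def)
  also have "\<dots> \<le> r * s" using s assms by (simp add: mult_left_mono)
  finally show ?thesis
    using assms s by (auto simp: nonneg_def intro!: exI[of _ "r * s"])
qed

lemma nonneg_norm_diff:
  assumes "adj a = a" "norm a \<le> r"
  shows "nonneg (of_real r - a)"
proof -
  have "0 \<le> r" using order_trans[OF norm_ge_zero assms(2)] .
  moreover have "norm (of_real r - (of_real r - a)) \<le> r" using assms(2) by simp
  moreover have "adj (of_real r - a) = of_real r - a" using assms(1) by simp
  ultimately show ?thesis unfolding nonneg_def by blast
qed

lemma nonneg_sqrt:
  fixes a :: "'a::unital_cstar_algebra"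
  assumes "nonneg a"
  obtains v where "adj v = v" "v * v = a" "v \<in> commutant (commutant {a})"
proof -
  obtain t where t: "t \<ge> 0" "norm (of_real t - a) \<le> t"
    using assms by (auto simp: nonneg_def)
  show thesis
  proof (cases "t = 0")
    case True
    then show thesis using t that[of 0] by (auto simp: commutant_def)
  next
    case False
    define y where "y = (1/t) *\<^sub>R (of_real t - a)"
    have y: "y = 1 - (1/t) *\<^sub>R a" using False by (simp add: y_def scaleR_diff_right of_real_def)
    have "adj y = y" using assms by (simp add: y_def nonneg_adj)
    moreover have "norm y \<le> 1" using t False by (simp add: y_def divide_simps)
    ultimately obtain z where z: "adj z = z" "z * z = 1 - y" "z \<in> commutant (commutant {y})"
      by (rule sqrt_one_minus)
    have "sqrt t *\<^sub>R z * (sqrt t *\<^sub>R z) = a"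
      using t False z(2) by (simp add: y)
    moreover have "sqrt t *\<^sub>R z \<in> commutant (commutant {a})"
      using z(3) by (auto simp: commutant_def y algebra_simps)
    ultimately show thesis using z(1) that[of "sqrt t *\<^sub>R z"] by simp
  qed
qed

text \<open>
  The element \<open>v + \<i>w\<close> is normal with \<open>|v + \<i>w|\<^sup>2 = v\<^sup>2 + w\<^sup>2 = K\<close>, so it is a multiple of a
  unitary, and \<open>w\<close> is its imaginary part.
\<close>

lemma norm_le_of_sum_squares:
  fixes v w :: "'a::unital_cstar_algebra"
  assumes vw: "adj v = v" "adj w = w" "v * w = w * v" and K: "v * v + w * w = of_real K" "K \<ge> 0"
  shows "(norm w)\<^sup>2 \<le> K"
proof -
  define u where "u = v + \<i> *\<^sub>c w"
  have au: "adj u = v - \<i> *\<^sub>c w"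
    using vw by (simp add: u_def adj_cscale)
  have "adj u * u = v * v + w * w"
    unfolding au unfolding u_def using vw
    by (simp add: algebra_simps mult_cscale_left mult_cscale_right cscale_cscale)
  then have "(norm u)\<^sup>2 = K"
    using K cstar_identity[of u] by simp
  moreover have "2 * norm w \<le> 2 * norm u"
  proof -
    have "u - adj u = (2 * \<i>) *\<^sub>c w"
      unfolding au unfolding u_def by (simp only: mult_2 cscale_add_left) simp
    then have "2 * norm w = norm (u - adj u)" by (simp add: norm_cscale norm_mult)
    also have "\<dots> \<le> 2 * norm u" using norm_triangle_ineq4[of u "adj u"] by simp
    finally show ?thesis .
  qed
  ultimately show ?thesis using power_mono[of "norm w" "norm u" 2] by simp
qed

text \<open>
  After scaling to norm one, \<open>w\<^sup>2\<close> and \<open>1 - w\<^sup>2 = k\<^sup>2\<close> are squares of commuting elements with sum one,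
  so \<open>\<parallel>1 - w\<^sup>2\<parallel> = \<parallel>k\<parallel>\<^sup>2 \<le> 1\<close>.
\<close>

lemma nonneg_square:
  fixes v :: "'a::unital_cstar_algebra"
  assumes "adj v = v"
  shows "nonneg (v * v)"
proof (cases "v = 0")
  case False
  define w where "w = (1 / norm v) *\<^sub>R v"
  have w: "adj w = w" "norm w = 1" using False assms by (auto simp: w_def)
  have "norm (w * w) \<le> 1" using norm_mult_ineq[of w w] w by simp
  moreover have "adj (w * w) = w * w" using w by (simp add: adj_mult)
  ultimately obtain k where k: "adj k = k" "k * k = 1 - w * w" "k \<in> commutant (commutant {w * w})"
    by (metis sqrt_one_minus)
  have "w \<in> commutant {w * w}" by (simp add: commutant_def mult.assoc)
  then have "w * k = k * w" using k(3) by (simp add: commutant_def)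
  then have "(norm k)\<^sup>2 \<le> 1" using w k by (intro norm_le_of_sum_squares[of w]) auto
  then have "norm (of_real 1 - w * w) \<le> 1"
    using norm_mult_ineq[of k k] k by (simp add: power2_eq_square)
  then have "nonneg (w * w)" using w by (auto simp: nonneg_def adj_mult intro!: exI[of _ 1])
  then have "nonneg ((norm v)\<^sup>2 *\<^sub>R (w * w))" by (intro nonneg_scaleR) auto
  then show ?thesis using False by (simp add: w_def power2_eq_square)
qed simp

lemma nonneg_mult:
  fixes a b :: "'a::unital_cstar_algebra"
  assumes "nonneg a" "nonneg b" "a * b = b * a"
  shows "nonneg (a * b)"
proof -
  obtain v where v: "adj v = v" "v * v = a" "v \<in> commutant (commutant {a})"
    using assms nonneg_sqrt by metis
  obtain w where w: "adj w = w" "w * w = b" "w \<in> commutant (commutant {b})"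
    using assms nonneg_sqrt by metis
  have "v * b = b * v" using v(3) assms(3) by (simp add: commutant_def)
  then have vw: "v * w = w * v" using w(3) by (simp add: commutant_def)
  then have "a * b = (v * w) * (v * w)" unfolding v(2)[symmetric] w(2)[symmetric]
    by (metis mult.assoc)
  then show ?thesis using nonneg_square[of "v * w"] v w vw by (simp add: adj_mult)
qed

text \<open>
  The roots of \<open>a\<close> and of \<open>K - a\<close> commute, because each of them lies in the bicommutant of \<open>a\<close>, and
  their squares add up to \<open>K\<close>.
\<close>

lemma norm_le_of_nonneg:
  fixes a :: "'a::unital_cstar_algebra"
  assumes "nonneg a" "nonneg (of_real K - a)" "K \<ge> 0"
  shows "norm a \<le> K"
proof -
  obtain v where v: "adj v = v" "v * v = a" "v \<in> commutant (commutant {a})"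
    using assms nonneg_sqrt by metis
  obtain w where w: "adj w = w" "w * w = of_real K - a" "w \<in> commutant (commutant {of_real K - a})"
    using assms nonneg_sqrt by metis
  have "v * a = a * v" using v(2) by (metis mult.assoc)
  then have "v * (of_real K - a) = (of_real K - a) * v" by (simp add: algebra_simps of_real_central)
  then have "w * v = v * w" using w(3) by (simp add: commutant_def)
  then have "(norm v)\<^sup>2 \<le> K" using v w assms by (intro norm_le_of_sum_squares[of w]) auto
  then show ?thesis using cstar_identity[of v] v by simp
qed

section \<open>Orderings of a commutative algebra\<close>

text \<open>
  Asking that \<open>C\<close> be its own bicommutant makes it closed in norm and under
  all algebraic operations, and also under inverses and square roots taken in the whole
  algebra.  In particular the spectrum of an element of \<open>C\<close> can be computed in \<open>C\<close>.
\<close>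

locale commutative_cstar =
  fixes C :: "'a::unital_cstar_algebra set"
  assumes comm: "a \<in> C \<Longrightarrow> b \<in> C \<Longrightarrow> a * b = b * a"
    and bicommutant_subset: "commutant (commutant C) \<subseteq> C"
    and adj_mem: "a \<in> C \<Longrightarrow> adj a \<in> C"
begin

lemma mem_iff: "a \<in> C \<longleftrightarrow> (\<forall>b\<in>commutant C. a * b = b * a)"
  using bicommutant_subset by (auto simp: commutant_def)

lemma add_mem: "a \<in> C \<Longrightarrow> b \<in> C \<Longrightarrow> a + b \<in> C"
  and diff_mem: "a \<in> C \<Longrightarrow> b \<in> C \<Longrightarrow> a - b \<in> C"
  and minus_mem: "a \<in> C \<Longrightarrow> - a \<in> C"
  and scaleR_mem: "a \<in> C \<Longrightarrow> r *\<^sub>R a \<in> C"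
  and cscale_mem: "a \<in> C \<Longrightarrow> k *\<^sub>c a \<in> C"
  and of_real_mem: "of_real r \<in> C"
  and one_mem: "1 \<in> C"
  and zero_mem: "0 \<in> C"
  unfolding mem_iff by (auto simp: algebra_simps mult_cscale_left mult_cscale_right of_real_central)

lemma mult_mem: "a \<in> C \<Longrightarrow> b \<in> C \<Longrightarrow> a * b \<in> C"
  unfolding mem_iff by (metis mult.assoc)

lemmas closure_rules = add_mem diff_mem minus_mem scaleR_mem cscale_mem of_real_mem one_mem zero_mem
  mult_mem adj_mem

lemma inverse_mem:
  assumes "c \<in> C" "c * d = 1" "d * c = 1"
  shows "d \<in> C"
  unfolding mem_iff
proof
  fix b assume "b \<in> commutant C"
  then have "c * b = b * c" using assms(1) mem_iff by blast
  then have "d * (c * b) * d = d * (b * c) * d" by simp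
  then show "d * b = b * d" using assms by (metis mult.assoc mult_1_left mult_1_right)
qed

lemma sqrt_mem:
  assumes "a \<in> C" "v \<in> commutant (commutant {a})"
  shows "v \<in> C"
  unfolding mem_iff
proof
  fix b assume "b \<in> commutant C"
  then have "b \<in> commutant {a}" using assms(1) unfolding commutant_def by blast
  then show "v * b = b * v" using assms(2) unfolding commutant_def by blast
qed

lemma closed_carrier: "closed C"
proof -
  have "C = (\<Inter>b\<in>commutant C. {a. a * b = b * a})" using mem_iff by blast
  also have "closed \<dots>" by (intro closed_INT ballI closed_Collect_eq continuous_intros)
  finally show ?thesis .
qed

text \<open>
  These are the preorderings of real algebra that extend the cone of non-negative elements.  Those
  that are maximal among the ones omitting \<open>-1\<close> play the part of maximal ideals: they
  correspond to characters.
\<close>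

definition preordering :: "'a set \<Rightarrow> bool" where
  "preordering Q \<longleftrightarrow> Q \<subseteq> {a\<in>C. adj a = a} \<and> {a\<in>C. nonneg a} \<subseteq> Q \<and>
     (\<forall>a\<in>Q. \<forall>b\<in>Q. a + b \<in> Q \<and> a * b \<in> Q)"

definition adjoin :: "'a set \<Rightarrow> 'a \<Rightarrow> 'a set" where
  "adjoin Q c = {p + q * c | p q. p \<in> Q \<and> q \<in> Q}"

lemma preordering_nonneg: "preordering {a\<in>C. nonneg a}"
  by (auto simp: preordering_def closure_rules nonneg_adj nonneg_add nonneg_mult comm)

lemma adjoin_preordering:
  assumes Q: "preordering Q" and c: "c \<in> C" "adj c = c"
  shows "preordering (adjoin Q c)" and "Q \<subseteq> adjoin Q c" and "c \<in> adjoin Q c"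
proof -
  note [simp] = closure_rules
  have QS: "a \<in> C" "adj a = a" if "a \<in> Q" for a using Q that by (auto simp: preordering_def)
  have Q0: "0 \<in> Q" "1 \<in> Q" using Q by (auto simp: preordering_def)
  have Qadd: "a + b \<in> Q" "a * b \<in> Q" if "a \<in> Q" "b \<in> Q" for a b
    using Q that by (auto simp: preordering_def)
  show sub: "Q \<subseteq> adjoin Q c"
  proof
    fix a assume "a \<in> Q"
    moreover have "a = a + 0 * c" by simp
    ultimately show "a \<in> adjoin Q c" using Q0 unfolding adjoin_def by blast
  qed
  show "c \<in> adjoin Q c"
  proof -
    have "c = 0 + 1 * c" by simp
    then show ?thesis unfolding adjoin_def using Q0 by blast
  qed
  have cc: "c * c \<in> Q" using Q c nonneg_square[of c] by (auto simp: preordering_def)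
  show "preordering (adjoin Q c)"
    unfolding preordering_def
  proof (intro conjI ballI)
    show "adjoin Q c \<subseteq> {a\<in>C. adj a = a}"
      using c by (auto simp: adjoin_def QS adj_mult comm)
    show "{a\<in>C. nonneg a} \<subseteq> adjoin Q c" using sub Q by (auto simp: preordering_def)
    fix a b assume "a \<in> adjoin Q c" "b \<in> adjoin Q c"
    then obtain p q p' q' where pq: "p \<in> Q" "q \<in> Q" "p' \<in> Q" "q' \<in> Q"
      "a = p + q * c" "b = p' + q' * c" by (auto simp: adjoin_def)
    have "a + b = (p + p') + (q + q') * c" using pq by (simp add: algebra_simps)
    then show "a + b \<in> adjoin Q c" unfolding adjoin_def using pq Qadd by blast
    have com: "c * p' = p' * c" "c * q' = q' * c" using comm[of c] c pq QS by blast+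
    have "a * b = p * p' + p * q' * c + q * (c * p') + q * (c * q') * c"
      using pq by (simp add: algebra_simps)
    also have "\<dots> = (p * p' + q * q' * (c * c)) + (p * q' + q * p') * c"
      unfolding com by (simp add: algebra_simps)
    finally have ab: "a * b = (p * p' + q * q' * (c * c)) + (p * q' + q * p') * c" .
    have "p * p' + q * q' * (c * c) \<in> Q" "p * q' + q * p' \<in> Q"
      using pq cc by (simp_all add: Qadd)
    with ab show "a * b \<in> adjoin Q c" unfolding adjoin_def by blast
  qed
qed

text \<open>
  If neither \<open>c\<close> nor \<open>-c\<close> can be adjoined, then \<open>-1 = p + qc\<close> and \<open>-1 = p' - q'c\<close>.  Multiplying
  \<open>qc = -(1 + p)\<close> by \<open>q'c = 1 + p'\<close> exhibits \<open>-1\<close> as an element of \<open>Q\<close>.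
\<close>

lemma preordering_total:
  assumes Q: "preordering Q" "-1 \<notin> Q"
    and max: "\<And>R. preordering R \<Longrightarrow> -1 \<notin> R \<Longrightarrow> Q \<subseteq> R \<Longrightarrow> R = Q"
    and c: "c \<in> C" "adj c = c"
  shows "c \<in> Q \<or> - c \<in> Q"
proof (rule ccontr)
  assume neg: "\<not> (c \<in> Q \<or> - c \<in> Q)"
  have QC: "a \<in> C" if "a \<in> Q" for a using Q that by (auto simp: preordering_def)
  have Qadd: "a + b \<in> Q" "a * b \<in> Q" if "a \<in> Q" "b \<in> Q" for a b
    using Q that by (auto simp: preordering_def)
  have "-1 \<in> adjoin Q c"
    using max[of "adjoin Q c"] adjoin_preordering[OF Q(1) c] neg by blast
  then obtain p q where pq: "p \<in> Q" "q \<in> Q" "-1 = p + q * c" by (auto simp: adjoin_def)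
  have "-1 \<in> adjoin Q (- c)"
    using max[of "adjoin Q (- c)"] adjoin_preordering[OF Q(1), of "- c"] neg c
    by (auto simp: closure_rules)
  then obtain p' q' where pq': "p' \<in> Q" "q' \<in> Q" "-1 = p' + q' * (- c)" by (auto simp: adjoin_def)
  have e1: "q * c = -1 - p" using pq(3) by (simp add: algebra_simps)
  have e2: "q' * c = 1 + p'" using pq'(3) by (simp add: algebra_simps)
  have "(q * c) * (q' * c) = q * q' * (c * c)"
    using comm[of c q'] c pq' QC by (metis mult.assoc)
  then have "-1 = p + p' + p * p' + q * q' * (c * c)"
    unfolding e1 e2 by (simp add: algebra_simps)
  moreover have "c * c \<in> Q" using Q c nonneg_square[of c] by (auto simp: preordering_def closure_rules)
  ultimately show False using Q(2) pq pq' Qadd by metis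
qed

lemma ex_maximal_preordering:
  assumes "preordering Q0" "-1 \<notin> Q0"
  obtains Q where "preordering Q" "-1 \<notin> Q" "Q0 \<subseteq> Q"
    "\<forall>c\<in>C. adj c = c \<longrightarrow> c \<in> Q \<or> - c \<in> Q"
proof -
  define \<A> where "\<A> = {Q. preordering Q \<and> -1 \<notin> Q \<and> Q0 \<subseteq> Q}"
  have "\<exists>M\<in>\<A>. \<forall>X\<in>\<A>. M \<subseteq> X \<longrightarrow> X = M"
  proof (rule subset_Zorn_nonempty)
    show "\<A> \<noteq> {}" using assms by (auto simp: \<A>_def)
    fix \<C> assume ne: "\<C> \<noteq> {}" and chain: "subset.chain \<A> \<C>"
    then have sub: "\<C> \<subseteq> \<A>" by (auto simp: subset_chain_def)
    have "a + b \<in> \<Union>\<C> \<and> a * b \<in> \<Union>\<C>" if ab: "a \<in> \<Union>\<C>" "b \<in> \<Union>\<C>" for a b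
    proof -
      obtain X Y where XY: "X \<in> \<C>" "Y \<in> \<C>" "a \<in> X" "b \<in> Y" using ab by blast
      have "X \<subseteq> Y \<or> Y \<subseteq> X" using chain XY by (auto simp: subset_chain_def)
      then obtain Z where "Z \<in> \<C>" "a \<in> Z" "b \<in> Z" using XY by blast
      moreover from this have "a + b \<in> Z \<and> a * b \<in> Z"
        using sub by (auto simp: \<A>_def preordering_def)
      ultimately show ?thesis by blast
    qed
    moreover obtain X where "X \<in> \<C>" using ne by blast
    moreover from this have "{a\<in>C. nonneg a} \<subseteq> X" "Q0 \<subseteq> X"
      using sub by (auto simp: \<A>_def preordering_def)
    ultimately have "{a\<in>C. nonneg a} \<subseteq> \<Union>\<C>" "Q0 \<subseteq> \<Union>\<C>"
      "\<And>a b. a \<in> \<Union>\<C> \<Longrightarrow> b \<in> \<Union>\<C> \<Longrightarrow> a + b \<in> \<Union>\<C> \<and> a * b \<in> \<Union>\<C>" by blast+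
    moreover have "\<Union>\<C> \<subseteq> {a\<in>C. adj a = a}" "-1 \<notin> \<Union>\<C>"
      using sub by (auto simp: \<A>_def preordering_def)
    ultimately show "\<Union>\<C> \<in> \<A>" by (simp add: \<A>_def preordering_def)
  qed
  then obtain M where "M \<in> \<A>" and M: "\<And>X. X \<in> \<A> \<Longrightarrow> M \<subseteq> X \<Longrightarrow> X = M" by blast
  then have *: "preordering M" "-1 \<notin> M" "Q0 \<subseteq> M" by (auto simp: \<A>_def)
  have "R = M" if "preordering R" "-1 \<notin> R" "M \<subseteq> R" for R
    using M[of R] that *(3) by (auto simp: \<A>_def)
  then have "c \<in> M \<or> - c \<in> M" if "c \<in> C" "adj c = c" for c
    using preordering_total[of M c] * that by blast
  with * that show thesis by blast
qed

end

section \<open>Characters\<close>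

lemma invertible_one_minus:
  fixes y :: "'a::unital_cstar_algebra"
  assumes "norm y < 1"
  shows "invertible_element (1 - y)"
proof -
  have s: "summable (\<lambda>n. y ^ n)" using complete_algebra_summable_geometric[OF assms] .
  define z where "z = (\<Sum>n. y ^ n)"
  have "z = 1 + (\<Sum>n. y ^ Suc n)"
    using suminf_split_initial_segment[OF s, of 1] by (simp add: z_def)
  then have "z = 1 + y * z" "z = 1 + z * y"
    using suminf_mult[OF s, of y] suminf_mult2[OF s, of y]
    by (simp_all add: z_def power_commutes[symmetric])
  then have "(1 - y) * z = 1" "z * (1 - y) = 1" by (simp_all add: algebra_simps)
  then show ?thesis unfolding invertible_element_def by blast
qed

lemma nonneg_add_one_invertible:
  fixes p :: "'a::unital_cstar_algebra"
  assumes "nonneg p"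
  shows "invertible_element (1 + p)"
proof -
  obtain t where t: "t \<ge> 0" "norm (of_real t - p) \<le> t"
    using assms by (auto simp: nonneg_def)
  define y where "y = (1 / (1 + t)) *\<^sub>R (of_real t - p)"
  have "norm y \<le> t / (1 + t)" using t by (simp add: y_def divide_right_mono)
  also have "\<dots> < 1" using t by simp
  finally obtain z where z: "(1 - y) * z = 1" "z * (1 - y) = 1"
    using invertible_one_minus[of y] by (auto simp: invertible_element_def)
  have "(1 + t) *\<^sub>R y = of_real t - p" using t by (simp add: y_def)
  then have "1 + p = (1 + t) *\<^sub>R (1 - y)"
    by (simp add: scaleR_diff_right scaleR_add_left of_real_def)
  then have "(1 + p) * ((1 / (1 + t)) *\<^sub>R z) = 1" "((1 / (1 + t)) *\<^sub>R z) * (1 + p) = 1"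
    using z t by simp_all
  then show ?thesis unfolding invertible_element_def by blast
qed

definition re_part :: "'a::unital_cstar_algebra \<Rightarrow> 'a" where
  "re_part a = (1/2) *\<^sub>c (a + adj a)"

definition im_part :: "'a::unital_cstar_algebra \<Rightarrow> 'a" where
  "im_part a = (- \<i> / 2) *\<^sub>c (a - adj a)"

lemma cscale_half_double: "(1/2) *\<^sub>c a + (1/2) *\<^sub>c a = (a :: 'a::unital_cstar_algebra)"
  using cscale_add_left[of "1/2" "1/2" a] by (simp add: cscale_one)

lemma re_part_adj [simp]: "adj (re_part a) = re_part a"
  and im_part_adj [simp]: "adj (im_part a) = im_part a"
  by (simp_all add: re_part_def im_part_def adj_cscale add.commute cvec.scale_right_diff_distrib)

lemma re_im_part: "a = re_part a + \<i> *\<^sub>c im_part a"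
proof -
  have "re_part a + \<i> *\<^sub>c im_part a = (1/2) *\<^sub>c a + (1/2) *\<^sub>c a"
    by (simp add: re_part_def im_part_def cscale_cscale cscale_add_right cvec.scale_right_diff_distrib)
  then show ?thesis by (simp add: cscale_half_double)
qed

lemma re_im_part_eq:
  assumes "adj p = p" "adj q = q"
  shows "re_part (p + \<i> *\<^sub>c q) = p" "im_part (p + \<i> *\<^sub>c q) = q"
  using assms cscale_half_double[of p] cscale_half_double[of q]
  by (simp_all add: re_part_def im_part_def adj_cscale cscale_cscale cscale_add_right)

text \<open>
  In terms of real and imaginary part the cross terms cancel, and what is left is
  \<open>2(p\<^sup>2 + q\<^sup>2)\<close>.  For normal \<open>c\<close> this settles the positivity of \<open>c\<^sup>*c\<close>; for general \<open>c\<close> it is the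
  first step.
\<close>

lemma nonneg_adj_mult_add:
  fixes c :: "'a::unital_cstar_algebra"
  shows "nonneg (adj c * c + c * adj c)"
proof -
  define p where "p = re_part c"
  define q where "q = im_part c"
  have c: "c = p + \<i> *\<^sub>c q" unfolding p_def q_def by (rule re_im_part)
  have sa: "adj p = p" "adj q = q" by (simp_all add: p_def q_def)
  have ac: "adj c = p - \<i> *\<^sub>c q" unfolding c by (simp add: sa adj_cscale)
  have "adj c * c + c * adj c = (p * p + p * p) + (q * q + q * q)"
    unfolding ac unfolding c
    by (simp add: algebra_simps mult_cscale_left mult_cscale_right cscale_cscale)
  then show ?thesis using nonneg_square[OF sa(1)] nonneg_square[OF sa(2)] by (simp add: nonneg_add)
qed

lemma nonneg_adj_mult_normal:
  assumes "normal_element c"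
  shows "nonneg (adj c * c)"
proof -
  have "(1/2) *\<^sub>R (adj c * c + c * adj c) = adj c * c"
    using assms by (simp add: normal_element_def)
  then show ?thesis using nonneg_scaleR[OF nonneg_adj_mult_add, of "1/2" c] by simp
qed

context commutative_cstar
begin

text \<open>
  A total ordering that omits \<open>-1\<close> is archimedean, as \<open>\<parallel>c\<parallel> \<plusminus> c\<close> is non-negative, so every
  self-adjoint \<open>c\<close> defines a cut of the real line.  The position of the cut is additive because \<open>Q\<close>
  is closed under sums and multiplicative because it is closed under products.
\<close>

lemma ex_real_character:
  assumes Q: "preordering Q" "-1 \<notin> Q"
    and total: "\<forall>c\<in>C. adj c = c \<longrightarrow> c \<in> Q \<or> - c \<in> Q"
  obtains \<rho> :: "'a \<Rightarrow> real" where
    "\<forall>a\<in>C. \<forall>b\<in>C. adj a = a \<longrightarrow> adj b = b \<longrightarrow>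
       \<rho> (a + b) = \<rho> a + \<rho> b \<and> \<rho> (a * b) = \<rho> a * \<rho> b"
    "\<forall>r. \<rho> (of_real r) = r" "\<forall>a\<in>Q. \<rho> a \<ge> 0"
proof -
  note [simp] = closure_rules
  define S where "S = {a\<in>C. adj a = a}"
  have QS: "Q \<subseteq> S" using Q by (auto simp: preordering_def S_def)
  have Qadd: "a + b \<in> Q" and Qmult: "a * b \<in> Q" if "a \<in> Q" "b \<in> Q" for a b
    using Q that by (auto simp: preordering_def)
  have Qnn: "a \<in> Q" if "a \<in> C" "nonneg a" for a using Q that by (auto simp: preordering_def)
  have Qreal: "of_real r \<in> Q" if "r \<ge> 0" for r using that by (intro Qnn) auto
  have real_nonneg: "r \<ge> 0" if "of_real r \<in> Q" for r
  proof (rule ccontr)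
    assume "\<not> r \<ge> 0"
    then have "of_real (inverse (- r)) * of_real r \<in> Q" using that by (intro Qmult[OF Qreal]) simp_all
    moreover have "of_real (inverse (- r)) * of_real r = (-1 :: 'a)"
      using \<open>\<not> r \<ge> 0\<close> unfolding of_real_mult[symmetric] by simp
    ultimately show False using Q by simp
  qed
  have S_add: "a + b \<in> S" "a - b \<in> S" if "a \<in> S" "b \<in> S" for a b
    using that by (auto simp: S_def)
  have S_mult: "a * b \<in> S" if "a \<in> S" "b \<in> S" for a b
    using that by (auto simp: S_def adj_mult comm)
  have S_real: "of_real r \<in> S" for r by (simp add: S_def)
  have norm_up: "of_real (norm c) - c \<in> Q" "of_real (norm c) + c \<in> Q" if "c \<in> S" for c
    using that nonneg_norm_diff[of c "norm c"] nonneg_norm_diff[of "- c" "norm c"]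
    by (auto intro!: Qnn simp: S_def)
  define \<rho> where "\<rho> c = Sup {r. c - of_real r \<in> Q}" for c
  have compare: "r \<le> r'" if "c - of_real r \<in> Q" "of_real r' - c \<in> Q" for c r r'
    using real_nonneg[of "r' - r"] Qadd[OF that] by simp
  have bdd: "bdd_above {r. c - of_real r \<in> Q}" if "c \<in> S" for c
    using compare norm_up(1)[OF that] by (auto intro!: bdd_aboveI[of _ "norm c"])
  have ne: "{r. c - of_real r \<in> Q} \<noteq> {}" if "c \<in> S" for c
  proof -
    have "c - of_real (- norm c) \<in> Q" using norm_up(2)[OF that] by (simp add: add.commute)
    then show ?thesis by blast
  qed
  have lower: "r \<le> \<rho> c" if "c \<in> S" "c - of_real r \<in> Q" for c r
    unfolding \<rho>_def using that bdd by (intro cSup_upper) auto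
  have upper: "\<rho> c \<le> r" if "c \<in> S" "of_real r - c \<in> Q" for c r
    unfolding \<rho>_def using that ne compare by (intro cSup_least) auto
  have above: "c - of_real (\<rho> c - e) \<in> Q" if c: "c \<in> S" and e: "e > 0" for c e
  proof -
    have "\<rho> c - e < Sup {r. c - of_real r \<in> Q}" using e by (simp add: \<rho>_def)
    then obtain r where r: "c - of_real r \<in> Q" "\<rho> c - e < r"
      using less_cSupD[OF ne[OF c]] by blast
    have "c - of_real r + of_real (r - (\<rho> c - e)) \<in> Q" using r by (intro Qadd Qreal) auto
    then show ?thesis by (simp add: algebra_simps)
  qed
  have below: "of_real (\<rho> c + e) - c \<in> Q" if c: "c \<in> S" and e: "e > 0" for c e
  proof -
    have "c - of_real (\<rho> c + e) \<notin> Q" using lower[OF c, of "\<rho> c + e"] e by auto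
    then show ?thesis
      using total[rule_format, of "c - of_real (\<rho> c + e)"] c by (simp add: S_def)
  qed
  have rho_add: "\<rho> (a + b) = \<rho> a + \<rho> b" if ab: "a \<in> S" "b \<in> S" for a b
  proof (rule antisym)
    show "\<rho> (a + b) \<le> \<rho> a + \<rho> b"
    proof (rule field_le_epsilon)
      fix e :: real assume e: "e > 0"
      have "of_real (\<rho> a + e/2) - a + (of_real (\<rho> b + e/2) - b) \<in> Q"
        using below ab e by (intro Qadd) auto
      also have "of_real (\<rho> a + e/2) - a + (of_real (\<rho> b + e/2) - b) =
          of_real (\<rho> a + \<rho> b + (e/2 + e/2)) - (a + b)"
        unfolding of_real_add by (simp add: algebra_simps)
      finally show "\<rho> (a + b) \<le> \<rho> a + \<rho> b + e" using upper[OF S_add(1)[OF ab]] by simp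
    qed
    show "\<rho> a + \<rho> b \<le> \<rho> (a + b)"
    proof (rule field_le_epsilon)
      fix e :: real assume e: "e > 0"
      have "a - of_real (\<rho> a - e/2) + (b - of_real (\<rho> b - e/2)) \<in> Q"
        using above ab e by (intro Qadd) auto
      also have "a - of_real (\<rho> a - e/2) + (b - of_real (\<rho> b - e/2)) =
          (a + b) - of_real (\<rho> a + \<rho> b - (e/2 + e/2))"
        unfolding of_real_add of_real_diff by (simp add: algebra_simps)
      finally have "\<rho> a + \<rho> b - (e/2 + e/2) \<le> \<rho> (a + b)" by (rule lower[OF S_add(1)[OF ab]])
      then show "\<rho> a + \<rho> b \<le> \<rho> (a + b) + e" by simp
    qed
  qed
  have rho_real: "\<rho> (of_real r) = r" for r
    using lower[OF S_real, of r r] upper[OF S_real, of r r] Qreal[of 0] by simp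
  have rho_mult_zero: "\<rho> (c * d) = 0" if cd: "c \<in> S" "d \<in> S" and "\<rho> c = 0" for c d
  proof -
    define D where "D = norm d"
    \<comment> \<open>The four elements \<open>e \<plusminus> c\<close> and \<open>D \<plusminus> d\<close> lie in \<open>Q\<close>; the products of matching and of
      opposite signs, added in pairs, bound \<open>cd\<close> from below and from above by \<open>\<plusminus>eD\<close>.\<close>
    have "\<bar>\<rho> (c * d)\<bar> \<le> 0 + e * D" if e: "e > 0" for e
    proof -
      have Qe: "of_real e - c \<in> Q" "of_real e + c \<in> Q"
        using below[OF cd(1) e] above[OF cd(1) e] \<open>\<rho> c = 0\<close> by (simp_all add: add.commute)
      have QD: "of_real D - d \<in> Q" "of_real D + d \<in> Q" using norm_up[OF cd(2)] by (simp_all add: D_def)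
      have "(of_real e + c) * (of_real D + d) + (of_real e - c) * (of_real D - d) \<in> Q"
        by (rule Qadd[OF Qmult[OF Qe(2) QD(2)] Qmult[OF Qe(1) QD(1)]])
      also have "(of_real e + c) * (of_real D + d) + (of_real e - c) * (of_real D - d) =
          (c * d + c * d) - of_real (- (e * D + e * D))"
        by (simp add: of_real_def algebra_simps) (simp flip: scaleR_add_left)
      finally have 1: "- (e * D + e * D) \<le> \<rho> (c * d + c * d)"
        using cd by (intro lower) (auto simp: S_add S_mult)
      have "(of_real e + c) * (of_real D - d) + (of_real e - c) * (of_real D + d) \<in> Q"
        by (rule Qadd[OF Qmult[OF Qe(2) QD(1)] Qmult[OF Qe(1) QD(2)]])
      also have "(of_real e + c) * (of_real D - d) + (of_real e - c) * (of_real D + d) =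
          of_real (e * D + e * D) - (c * d + c * d)"
        by (simp add: of_real_def algebra_simps) (simp flip: scaleR_add_left)
      finally have 2: "\<rho> (c * d + c * d) \<le> e * D + e * D"
        using cd by (intro upper) (auto simp: S_add S_mult)
      have "\<rho> (c * d + c * d) = \<rho> (c * d) + \<rho> (c * d)"
        using cd by (intro rho_add) (auto simp: S_mult)
      with 1 2 show ?thesis by (simp add: abs_le_iff mult.commute)
    qed
    note bound = this
    have "\<bar>\<rho> (c * d)\<bar> \<le> 0 + e" if e: "e > 0" for e
    proof -
      have D: "D \<ge> 0" by (simp add: D_def)
      then have "\<bar>\<rho> (c * d)\<bar> \<le> 0 + e / (D + 1) * D" using e by (intro bound) auto
      also have "\<dots> \<le> e" using D e by (simp add: field_simps)
      finally show ?thesis by simp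
    qed
    then have "\<bar>\<rho> (c * d)\<bar> \<le> 0" by (rule field_le_epsilon)
    then show ?thesis by simp
  qed
  have centre: "a - of_real (\<rho> a) \<in> S" "\<rho> (a - of_real (\<rho> a)) = 0" if "a \<in> S" for a
  proof -
    show "a - of_real (\<rho> a) \<in> S" using that S_add S_real by blast
    then have "\<rho> ((a - of_real (\<rho> a)) + of_real (\<rho> a)) = \<rho> (a - of_real (\<rho> a)) + \<rho> a"
      using rho_add[OF _ S_real, of "a - of_real (\<rho> a)" "\<rho> a"] by (simp only: rho_real)
    then show "\<rho> (a - of_real (\<rho> a)) = 0" by simp
  qed
  have rho_scale: "\<rho> (b * of_real r) = \<rho> b * r" if b: "b \<in> S" for b r
  proof -
    have "b * of_real r = (b - of_real (\<rho> b)) * of_real r + of_real (\<rho> b * r)"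
      by (simp add: left_diff_distrib)
    also have "\<rho> \<dots> = \<rho> ((b - of_real (\<rho> b)) * of_real r) + \<rho> (of_real (\<rho> b * r))"
      using S_mult[OF centre(1)[OF b] S_real[of r]] S_real by (intro rho_add)
    also have "\<dots> = \<rho> b * r"
      using rho_mult_zero[OF centre(1)[OF b] S_real[of r] centre(2)[OF b]] rho_real
      by (simp del: of_real_mult)
    finally show ?thesis .
  qed
  have rho_mult: "\<rho> (a * b) = \<rho> a * \<rho> b" if a: "a \<in> S" and b: "b \<in> S" for a b
  proof -
    have "a * b = (a - of_real (\<rho> a)) * b + b * of_real (\<rho> a)"
      by (simp add: left_diff_distrib of_real_central)
    also have "\<rho> \<dots> = \<rho> ((a - of_real (\<rho> a)) * b) + \<rho> (b * of_real (\<rho> a))"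
      using S_mult[OF centre(1)[OF a] b] S_mult[OF b S_real] by (intro rho_add)
    also have "\<dots> = \<rho> a * \<rho> b"
      using rho_mult_zero[OF centre(1)[OF a] b centre(2)[OF a]] rho_scale[OF b] by simp
    finally show ?thesis .
  qed
  have "\<rho> a \<ge> 0" if "a \<in> Q" for a
    using lower[of a 0] that QS by auto
  with rho_add rho_mult rho_real show thesis by (intro that[of \<rho>]) (auto simp: S_def)
qed

definition character :: "('a \<Rightarrow> complex) \<Rightarrow> bool" where
  "character \<phi> \<longleftrightarrow>
     (\<forall>a\<in>C. \<forall>b\<in>C. \<phi> (a + b) = \<phi> a + \<phi> b \<and> \<phi> (a * b) = \<phi> a * \<phi> b) \<and>
     (\<forall>a\<in>C. \<forall>k. \<phi> (k *\<^sub>c a) = k * \<phi> a) \<and> (\<forall>a\<in>C. \<phi> (adj a) = cnj (\<phi> a)) \<and> \<phi> 1 = 1"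

lemma part_mem: "a \<in> C \<Longrightarrow> re_part a \<in> C" "a \<in> C \<Longrightarrow> im_part a \<in> C"
  by (simp_all add: re_part_def im_part_def closure_rules)

text \<open>
  Unless a certificate \<open>-1 = p + qa\<close> exists, \<open>a\<close> can be declared non-negative, and a maximal
  ordering containing \<open>a\<close> yields a real character, which extends to complex combinations.
\<close>

lemma ex_character:
  assumes a: "a \<in> C" "adj a = a"
    and proper: "\<And>p q. p \<in> C \<Longrightarrow> nonneg p \<Longrightarrow> q \<in> C \<Longrightarrow> nonneg q \<Longrightarrow> p + q * a \<noteq> -1"
  obtains \<phi> where "character \<phi>" "Re (\<phi> a) \<ge> 0"
proof -
  note [simp] = closure_rules part_mem
  have proper': "-1 \<notin> adjoin {a\<in>C. nonneg a} a"
    using proper by (auto simp: adjoin_def) metis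
  obtain Q where Q: "preordering Q" "-1 \<notin> Q" "adjoin {a\<in>C. nonneg a} a \<subseteq> Q"
    "\<forall>c\<in>C. adj c = c \<longrightarrow> c \<in> Q \<or> - c \<in> Q"
    by (rule ex_maximal_preordering[OF adjoin_preordering(1)[OF preordering_nonneg a] proper'])
  obtain \<rho> :: "'a \<Rightarrow> real" where \<rho>0:
    "\<forall>a\<in>C. \<forall>b\<in>C. adj a = a \<longrightarrow> adj b = b \<longrightarrow>
       \<rho> (a + b) = \<rho> a + \<rho> b \<and> \<rho> (a * b) = \<rho> a * \<rho> b"
    "\<forall>r. \<rho> (of_real r) = r" "\<forall>a\<in>Q. \<rho> a \<ge> 0"
    by (rule ex_real_character[OF Q(1,2,4)])
  note \<rho> = \<rho>0(1)[rule_format] \<rho>0(2)[rule_format] \<rho>0(3)[rule_format]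
  have rho_real: "\<rho> (r *\<^sub>R b) = r * \<rho> b" if "b \<in> C" "adj b = b" for r b
    using \<rho>(1)[of "of_real r" b] \<rho>(2)[of r] that by (simp add: scaleR_conv_of_real)
  have rho_minus: "\<rho> (b - c) = \<rho> b - \<rho> c" if "b \<in> C" "adj b = b" "c \<in> C" "adj c = c" for b c
    using \<rho>(1)[of "b - c" c] that by simp
  define \<phi> where "\<phi> a = Complex (\<rho> (re_part a)) (\<rho> (im_part a))" for a
  have chi: "\<phi> (p + \<i> *\<^sub>c q) = Complex (\<rho> p) (\<rho> q)" if "adj p = p" "adj q = q" for p q
    using that by (simp add: \<phi>_def re_im_part_eq)
  have chi_real: "\<phi> p = of_real (\<rho> p)" if "adj p = p" for p
    using chi[of p 0] \<rho>(2)[of 0] that by (simp add: complex_eq_iff)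
  have "character \<phi>"
    unfolding character_def
  proof (intro conjI ballI allI)
    fix b c assume bc: "b \<in> C" "c \<in> C"
    define p q p' q' where pq: "p = re_part b" "q = im_part b" "p' = re_part c" "q' = im_part c"
    have [simp]: "adj p = p" "adj q = q" "adj p' = p'" "adj q' = q'" "p \<in> C" "q \<in> C" "p' \<in> C" "q' \<in> C"
      using bc by (simp_all add: pq)
    have b: "b = p + \<i> *\<^sub>c q" and c: "c = p' + \<i> *\<^sub>c q'"
      unfolding pq by (rule re_im_part)+
    have cm: "q * p' = p' * q" "p * p' = p' * p" "q * q' = q' * q" "q' * p = p * q'"
      using comm by auto
    have sa: "adj (p * p' - q * q') = p * p' - q * q'" "adj (p * q' + q * p') = p * q' + q * p'"
      using cm by (simp_all add: adj_mult)
    have sum: "b + c = (p + p') + \<i> *\<^sub>c (q + q')" by (simp add: b c cscale_add_right)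
    have "\<phi> (b + c) = Complex (\<rho> (p + p')) (\<rho> (q + q'))"
      unfolding sum by (rule chi) simp_all
    also have "\<dots> = \<phi> b + \<phi> c"
      using \<rho>(1) by (simp add: b c chi complex_eq_iff)
    finally show "\<phi> (b + c) = \<phi> b + \<phi> c" .
    have prod: "b * c = (p * p' - q * q') + \<i> *\<^sub>c (p * q' + q * p')"
      by (simp add: b c algebra_simps cscale_add_right mult_cscale_left mult_cscale_right cscale_cscale)
    have "\<phi> (b * c) = Complex (\<rho> (p * p' - q * q')) (\<rho> (p * q' + q * p'))"
      unfolding prod by (rule chi) (fact sa)+
    also have "\<dots> = \<phi> b * \<phi> c"
      using \<rho>(1) cm by (simp add: b c chi complex_eq_iff rho_minus adj_mult)
    finally show "\<phi> (b * c) = \<phi> b * \<phi> c" .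
  next
    fix b k assume b: "b \<in> C"
    define p q where pq: "p = re_part b" "q = im_part b"
    have [simp]: "adj p = p" "adj q = q" "p \<in> C" "q \<in> C" using b by (simp_all add: pq)
    have b': "b = p + \<i> *\<^sub>c q" unfolding pq by (rule re_im_part)
    have k: "k *\<^sub>c c = Re k *\<^sub>R c + \<i> *\<^sub>c (Im k *\<^sub>R c)" for c :: 'a
      using arg_cong[OF complex_eq[of k], of "\<lambda>k. k *\<^sub>c c"]
      by (simp add: cscale_add_left cscale_cscale flip: cscale_of_real)
    have scaled: "k *\<^sub>c b = (Re k *\<^sub>R p - Im k *\<^sub>R q) + \<i> *\<^sub>c (Re k *\<^sub>R q + Im k *\<^sub>R p)"
      unfolding k[of b] unfolding b'
      by (simp add: algebra_simps cscale_add_right cscale_cscale flip: cscale_of_real)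
    have "\<phi> (k *\<^sub>c b) = Complex (\<rho> (Re k *\<^sub>R p - Im k *\<^sub>R q)) (\<rho> (Re k *\<^sub>R q + Im k *\<^sub>R p))"
      unfolding scaled by (rule chi) simp_all
    also have "\<dots> = k * \<phi> b"
      using \<rho>(1) by (simp add: b' chi complex_eq_iff rho_minus rho_real)
    finally show "\<phi> (k *\<^sub>c b) = k * \<phi> b" .
    have conj: "adj b = p + \<i> *\<^sub>c (- q)" by (simp add: b' adj_cscale)
    have "\<phi> (adj b) = Complex (\<rho> p) (\<rho> (- q))"
      unfolding conj by (rule chi) simp_all
    moreover have "\<rho> (- q) = - \<rho> q" using rho_minus[of 0 q] \<rho>(2)[of 0] by simp
    ultimately show "\<phi> (adj b) = cnj (\<phi> b)" by (simp add: b' chi complex_eq_iff)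
  next
    show "\<phi> 1 = 1" using chi_real[of 1] \<rho>(2)[of 1] by simp
  qed
  moreover have "a \<in> Q" using Q(3) adjoin_preordering(3)[OF preordering_nonneg a] by blast
  then have "Re (\<phi> a) \<ge> 0" using chi_real[OF a(2)] \<rho>(3) by simp
  ultimately show thesis using that by blast
qed

end

section \<open>The Gelfand transform\<close>

context commutative_cstar
begin

context
  fixes \<phi> assumes \<phi>: "character \<phi>"
begin

lemma character_add: "a \<in> C \<Longrightarrow> b \<in> C \<Longrightarrow> \<phi> (a + b) = \<phi> a + \<phi> b"
  and character_mult: "a \<in> C \<Longrightarrow> b \<in> C \<Longrightarrow> \<phi> (a * b) = \<phi> a * \<phi> b"
  and character_cscale: "a \<in> C \<Longrightarrow> \<phi> (k *\<^sub>c a) = k * \<phi> a"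
  and character_adj: "a \<in> C \<Longrightarrow> \<phi> (adj a) = cnj (\<phi> a)"
  and character_one: "\<phi> 1 = 1"
  using \<phi> by (auto simp: character_def)

lemma character_diff: "a \<in> C \<Longrightarrow> b \<in> C \<Longrightarrow> \<phi> (a - b) = \<phi> a - \<phi> b"
  using character_add[of "a - b" b] by (simp add: closure_rules)

lemma character_of_real: "\<phi> (of_real r) = of_real r"
proof -
  have "of_real r = complex_of_real r *\<^sub>c (1::'a)" unfolding cscale_of_real by (rule of_real_def)
  then show ?thesis using character_cscale[OF one_mem, of "complex_of_real r"] character_one by simp
qed

lemma character_minus: "a \<in> C \<Longrightarrow> \<phi> (- a) = - \<phi> a"
  using character_diff[OF zero_mem, of a] character_of_real[of 0] by simp

lemmas character_simps = character_add character_mult character_cscale character_adj character_one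
  character_diff character_minus character_of_real

lemma character_nonneg:
  assumes "a \<in> C" "nonneg a"
  shows "\<phi> a \<in> \<real>\<^sub>\<ge>\<^sub>0"
proof -
  obtain v where v: "adj v = v" "v * v = a" "v \<in> commutant (commutant {a})"
    using nonneg_sqrt[OF assms(2)] by metis
  have "v \<in> C" using sqrt_mem assms v by blast
  then have "cnj (\<phi> v) = \<phi> v" "\<phi> a = \<phi> v * \<phi> v"
    using character_adj[of v] character_mult[of v v] v by simp_all
  then show ?thesis by (auto simp: complex_nonneg_Reals_iff complex_eq_iff)
qed

text \<open>
  Evaluate the character at the non-negative element \<open>\<parallel>c\<parallel>\<^sup>2 - c\<^sup>*c\<close>.
\<close>

lemma norm_character_le:
  assumes "c \<in> C"
  shows "cmod (\<phi> c) \<le> norm c"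
proof -
  have "nonneg (of_real ((norm c)\<^sup>2) - adj c * c)"
    by (rule nonneg_norm_diff) (simp_all add: adj_mult cstar_identity)
  then have "\<phi> (of_real ((norm c)\<^sup>2) - adj c * c) \<in> \<real>\<^sub>\<ge>\<^sub>0"
    using assms by (intro character_nonneg) (simp_all add: closure_rules del: of_real_power)
  also have "\<phi> (of_real ((norm c)\<^sup>2) - adj c * c) = of_real ((norm c)\<^sup>2 - (cmod (\<phi> c))\<^sup>2)"
  proof -
    have "\<phi> (of_real ((norm c)\<^sup>2) - adj c * c) = of_real ((norm c)\<^sup>2) - cnj (\<phi> c) * \<phi> c"
      using assms by (simp add: character_diff character_mult character_adj character_of_real closure_rules
          del: of_real_power)
    then show ?thesis by (simp add: complex_norm_square mult.commute del: of_real_power)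
  qed
  finally have "(cmod (\<phi> c))\<^sup>2 \<le> (norm c)\<^sup>2" by (simp add: complex_nonneg_Reals_iff)
  then show ?thesis by (rule power2_le_imp_le) simp
qed

end

text \<open>
  With \<open>b = c\<^sup>*c\<close> and \<open>N = \<parallel>b\<parallel>\<close> it suffices to find a character that is at least \<open>N\<close> at \<open>b\<close>.  The
  certificate \<open>q(N - b) = 1 + p\<close> against it is impossible: with \<open>q \<le> K\<close> it gives
  \<open>K(N - b) \<ge> 1\<close>, hence \<open>\<parallel>b\<parallel> \<le> N - 1/K < N\<close>.
\<close>

lemma norm_le_of_characters:
  assumes c: "c \<in> C" and M: "M \<ge> 0" and le: "\<And>\<phi>. character \<phi> \<Longrightarrow> cmod (\<phi> c) \<le> M"
  shows "norm c \<le> M"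
proof (rule ccontr)
  assume "\<not> norm c \<le> M"
  then have Mc: "M < norm c" by simp
  define b where "b = adj c * c"
  define N where "N = norm b"
  have N: "N = (norm c)\<^sup>2" "N > 0" using Mc M by (auto simp: N_def b_def cstar_identity)
  have b: "b \<in> C" "adj b = b" using c by (simp_all add: b_def adj_mult closure_rules)
  have bnn: "nonneg b" unfolding b_def 
    by (rule nonneg_adj_mult_normal) (simp add: normal_element_def comm c adj_mem)
  have Nb: "nonneg (of_real N - b)" using b by (auto simp: N_def intro!: nonneg_norm_diff)
  show False
  proof (cases "\<exists>p q. p \<in> C \<and> nonneg p \<and> q \<in> C \<and> nonneg q \<and> p + q * (b - of_real N) = -1")
    case True
    then obtain p q where pq: "p \<in> C" "nonneg p" "q \<in> C" "nonneg q" "p + q * (b - of_real N) = -1"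
      by blast
    \<comment> \<open>The summand \<open>1/N\<close> makes \<open>N - 1/K\<close> non-negative, as the norm bound requires.\<close>
    define K where "K = norm q + 1 / N"
    have K: "K > 0" "N - 1 / K \<ge> 0" "norm q \<le> K"
    proof -
      have "1 / N > 0" using N by simp
      then show "K > 0" "norm q \<le> K" by (auto simp: K_def add_nonneg_pos)
      have "1 / K \<le> 1 / (1 / N)"
        using \<open>1 / N > 0\<close> by (intro divide_left_mono) (auto simp: K_def add_nonneg_pos)
      then show "N - 1 / K \<ge> 0" by simp
    qed
    have e: "q * (of_real N - b) = 1 + p" using pq(5) by (simp add: algebra_simps)
    have "nonneg ((of_real K - q) * (of_real N - b))"
      using pq b by (intro nonneg_mult[OF nonneg_norm_diff[OF nonneg_adj[OF pq(4)] K(3)] Nb] comm)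
        (simp_all add: closure_rules)
    then have "nonneg ((of_real K - q) * (of_real N - b) + p)" using pq nonneg_add by blast
    also have "(of_real K - q) * (of_real N - b) + p = of_real K * (of_real N - b) - 1"
      using e by (simp add: left_diff_distrib)
    finally have "nonneg ((1 / K) *\<^sub>R (of_real K * (of_real N - b) - 1))"
      using K by (intro nonneg_scaleR) auto
    also have "(1 / K) *\<^sub>R (of_real K * (of_real N - b) - 1) = of_real (N - 1 / K) - b"
      using K by (simp add: of_real_def algebra_simps)
    finally have "norm b \<le> N - 1 / K" using bnn K by (intro norm_le_of_nonneg)
    then show False using K by (simp add: N_def)
  next
    case False
    then obtain \<phi> where phi: "character \<phi>" "Re (\<phi> (b - of_real N)) \<ge> 0"
      using ex_character[of "b - of_real N"] b by (auto simp: closure_rules)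
    have "\<phi> (b - of_real N) = cnj (\<phi> c) * \<phi> c - of_real N"
      using phi(1) c by (simp add: b_def character_simps closure_rules)
    also have "\<dots> = of_real ((cmod (\<phi> c))\<^sup>2 - N)"
      by (simp add: complex_norm_square mult.commute del: of_real_power)
    finally have "N \<le> (cmod (\<phi> c))\<^sup>2" using phi(2) by simp
    also have "\<dots> \<le> M\<^sup>2" using le[OF phi(1)] by (intro power_mono) auto
    also have "\<dots> < (norm c)\<^sup>2" using Mc M by (intro power_strict_mono) auto
    finally show False using N by simp
  qed
qed

lemma eq_of_characters:
  assumes "a \<in> C" "b \<in> C" "\<And>\<phi>. character \<phi> \<Longrightarrow> \<phi> a = \<phi> b"
  shows "a = b"
  using norm_le_of_characters[of "a - b" 0] assms by (simp add: closure_rules character_diff)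

text \<open>
  A character that is at least \<open>0\<close> at \<open>-c\<^sup>*c\<close> vanishes at \<open>c\<close>.  The certificate against it reads
  \<open>qc\<^sup>*c = 1 + p\<close>, and its right side is invertible, so \<open>c\<close> is invertible as well.
\<close>

lemma ex_character_zero:
  assumes c: "c \<in> C" and "\<not> invertible_element c"
  obtains \<phi> where "character \<phi>" "\<phi> c = 0"
proof (cases "\<exists>p q. p \<in> C \<and> nonneg p \<and> q \<in> C \<and> nonneg q \<and> p + q * (- (adj c * c)) = -1")
  case True
  then obtain p q where pq: "p \<in> C" "nonneg p" "q \<in> C" "nonneg q" "p + q * (- (adj c * c)) = -1"
    by blast
  have e: "q * adj c * c = 1 + p" using pq(5) by (simp add: algebra_simps)
  obtain d where d: "(1 + p) * d = 1" "d * (1 + p) = 1"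
    using nonneg_add_one_invertible[OF pq(2)] by (auto simp: invertible_element_def)
  have dC: "d \<in> C" using inverse_mem[OF _ d] pq by (simp add: closure_rules)
  have "(d * (q * adj c)) * c = 1" using e d by (simp add: mult.assoc)
  moreover have "c * (d * (q * adj c)) = (d * (q * adj c)) * c"
    by (rule comm) (auto simp: closure_rules c dC pq)
  ultimately have "invertible_element c" unfolding invertible_element_def by metis
  with assms show thesis by simp
next
  case False
  then obtain \<phi> where phi: "character \<phi>" "Re (\<phi> (- (adj c * c))) \<ge> 0"
    using ex_character[of "- (adj c * c)"] c by (auto simp: closure_rules adj_mult)
  have "\<phi> (- (adj c * c)) = - (cnj (\<phi> c) * \<phi> c)"
    using phi(1) c by (simp add: character_simps closure_rules)
  also have "\<dots> = - of_real ((cmod (\<phi> c))\<^sup>2)"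
    by (simp add: complex_norm_square mult.commute del: of_real_power)
  finally have "\<phi> c = 0" using phi(2) by simp
  with phi that show thesis by blast
qed

lemma spectrum_eq_characters:
  assumes x: "x \<in> C"
  shows "spectrum x = {\<phi> x | \<phi>. character \<phi>}"
proof (intro set_eqI iffI)
  fix \<mu> assume "\<mu> \<in> spectrum x"
  then have "\<not> invertible_element (\<mu> *\<^sub>c 1 - x)" by (simp add: spectrum_def)
  then obtain \<phi> where "character \<phi>" "\<phi> (\<mu> *\<^sub>c 1 - x) = 0"
    using ex_character_zero[of "\<mu> *\<^sub>c 1 - x"] x by (auto simp: closure_rules)
  moreover from this have "\<phi> x = \<mu>" using x by (simp add: character_simps closure_rules)
  ultimately show "\<mu> \<in> {\<phi> x | \<phi>. character \<phi>}" by blast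
next
  fix \<mu> assume "\<mu> \<in> {\<phi> x | \<phi>. character \<phi>}"
  then obtain \<phi> where phi: "character \<phi>" "\<mu> = \<phi> x" by blast
  show "\<mu> \<in> spectrum x"
  proof (rule ccontr)
    assume "\<mu> \<notin> spectrum x"
    then obtain d where d: "(\<mu> *\<^sub>c 1 - x) * d = 1" "d * (\<mu> *\<^sub>c 1 - x) = 1"
      by (auto simp: spectrum_def invertible_element_def)
    then have "d \<in> C" using inverse_mem[OF _ d] x by (simp add: closure_rules)
    then have "\<phi> ((\<mu> *\<^sub>c 1 - x) * d) = (\<mu> - \<phi> x) * \<phi> d"
      using phi(1) x by (simp add: character_simps closure_rules)
    then show False using d phi by (simp add: character_one)
  qed
qed

lemma compact_spectrum:
  assumes x: "x \<in> C"
  shows "compact (spectrum x)"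
  unfolding compact_eq_bounded_closed
proof
  show "bounded (spectrum x)"
    using norm_character_le x by (auto simp: spectrum_eq_characters[OF x] bounded_iff)
  have "open (- spectrum x)"
    unfolding open_contains_ball
  proof
    fix \<mu> assume "\<mu> \<in> - spectrum x"
    then obtain d where d: "(\<mu> *\<^sub>c 1 - x) * d = 1" "d * (\<mu> *\<^sub>c 1 - x) = 1"
      by (auto simp: spectrum_def invertible_element_def)
    have "d \<noteq> 0" using d by auto
    have dC: "d \<in> C" using inverse_mem[OF _ d] x by (simp add: closure_rules)
    \<comment> \<open>If \<open>d\<close> inverts \<open>\<mu> - x\<close>, then \<open>1 = |\<mu> - \<phi>(x)| |\<phi>(d)| \<le> |\<mu> - \<phi>(x)| \<parallel>d\<parallel>\<close>.\<close>
    have "\<phi> x \<notin> ball \<mu> (1 / norm d)" if phi: "character \<phi>" for \<phi>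
    proof -
      have "(\<mu> - \<phi> x) * \<phi> d = \<phi> ((\<mu> *\<^sub>c 1 - x) * d)"
        using phi x dC by (simp add: character_simps closure_rules)
      then have "1 = cmod (\<mu> - \<phi> x) * cmod (\<phi> d)"
        using d phi by (simp add: character_one flip: norm_mult)
      also have "\<dots> \<le> cmod (\<mu> - \<phi> x) * norm d"
        using norm_character_le[OF phi dC] by (intro mult_left_mono) auto
      finally show ?thesis using \<open>d \<noteq> 0\<close> by (simp add: dist_norm field_simps)
    qed
    then have "ball \<mu> (1 / norm d) \<subseteq> - spectrum x" by (auto simp: spectrum_eq_characters[OF x])
    then show "\<exists>e>0. ball \<mu> e \<subseteq> - spectrum x" using \<open>d \<noteq> 0\<close> by (intro exI[of _ "1 / norm d"]) simp
  qed
  then show "closed (spectrum x)" by (simp add: closed_def)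
qed

section \<open>The continuous functional calculus\<close>

text \<open>
  The real functions on the spectrum that are transforms of elements of \<open>C\<close> form an algebra that contains \<open>Re\<close> and
  \<open>Im\<close>.  By Stone and Weierstrass they are uniformly dense, and the norm formula turns uniform
  approximations into Cauchy sequences in \<open>C\<close>.
\<close>

lemma ex_transform_real:
  fixes f :: "complex \<Rightarrow> real"
  assumes x: "x \<in> C" and f: "continuous_on (spectrum x) f"
  obtains c where "c \<in> C" "\<And>\<phi>. character \<phi> \<Longrightarrow> \<phi> c = of_real (f (\<phi> x))"
proof -
  define R where "R = {r :: complex \<Rightarrow> real. continuous_on (spectrum x) r \<and>
    (\<exists>c\<in>C. \<forall>\<phi>. character \<phi> \<longrightarrow> \<phi> c = of_real (r (\<phi> x)))}"
  have R_part: "Re \<in> R" "Im \<in> R"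
  proof -
    have "\<phi> (re_part x) = of_real (Re (\<phi> x))" "\<phi> (im_part x) = of_real (Im (\<phi> x))"
      if "character \<phi>" for \<phi>
      using that x by (simp_all add: re_part_def im_part_def character_simps closure_rules complex_eq_iff)
    then show "Re \<in> R" "Im \<in> R"
      using part_mem[OF x] by (auto simp: R_def intro!: continuous_intros)
  qed
  interpret function_ring_on R "spectrum x"
  proof
    show "compact (spectrum x)" by (rule compact_spectrum[OF x])
    show "continuous_on (spectrum x) r" if "r \<in> R" for r using that by (simp add: R_def)
    fix r s assume "r \<in> R" "s \<in> R"
    then obtain c d where rs: "continuous_on (spectrum x) r" "continuous_on (spectrum x) s"
      and c: "c \<in> C" "\<And>\<phi>. character \<phi> \<Longrightarrow> \<phi> c = of_real (r (\<phi> x))"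
      and d: "d \<in> C" "\<And>\<phi>. character \<phi> \<Longrightarrow> \<phi> d = of_real (s (\<phi> x))"
      by (auto simp: R_def)
    show "(\<lambda>z. r z + s z) \<in> R"
      using rs c d by (auto simp: R_def character_add closure_rules intro!: continuous_intros bexI[of _ "c + d"])
    show "(\<lambda>z. r z * s z) \<in> R"
      using rs c d by (auto simp: R_def character_mult closure_rules intro!: continuous_intros bexI[of _ "c * d"])
  next
    show "(\<lambda>_. k) \<in> R" for k :: real
      by (auto simp: R_def character_of_real closure_rules intro!: bexI[of _ "of_real k"])
    show "\<exists>r\<in>R. r z \<noteq> r w" if "z \<noteq> w" for z w :: complex
      using R_part that by (auto simp: complex_eq_iff)
  qed
  have "\<exists>g\<in>R. \<forall>z\<in>spectrum x. \<bar>f z - g z\<bar> < 1 / Suc n" for n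
    using Stone_Weierstrass_basic[OF f, of "1 / Suc n"] by simp
  then have "\<exists>c\<in>C. \<forall>\<phi>. character \<phi> \<longrightarrow> cmod (of_real (f (\<phi> x)) - \<phi> c) < 1 / Suc n" for n
  proof -
    assume "\<And>n. \<exists>g\<in>R. \<forall>z\<in>spectrum x. \<bar>f z - g z\<bar> < 1 / Suc n"
    then obtain g where "g \<in> R" and g: "\<forall>z\<in>spectrum x. \<bar>f z - g z\<bar> < 1 / Suc n" by blast
    then obtain c where c: "c \<in> C" "\<forall>\<phi>. character \<phi> \<longrightarrow> \<phi> c = of_real (g (\<phi> x))"
      by (auto simp: R_def)
    have "cmod (of_real (f (\<phi> x)) - \<phi> c) < 1 / Suc n" if "character \<phi>" for \<phi>
    proof -
      have "\<phi> x \<in> spectrum x" using that by (auto simp: spectrum_eq_characters[OF x])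
      then have "\<bar>f (\<phi> x) - g (\<phi> x)\<bar> < 1 / Suc n" using g by blast
      moreover have "of_real (f (\<phi> x)) - \<phi> c = of_real (f (\<phi> x) - g (\<phi> x))" using c(2) that by simp
      ultimately show ?thesis by (simp only: norm_of_real)
    qed
    with c(1) show ?thesis by blast
  qed
  then obtain c where c: "\<And>n. c n \<in> C"
    and close: "\<And>n \<phi>. character \<phi> \<Longrightarrow> cmod (of_real (f (\<phi> x)) - \<phi> (c n)) < 1 / Suc n"
    by metis
  have diff: "norm (c m - c n) \<le> 1 / Suc m + 1 / Suc n" for m n
  proof (rule norm_le_of_characters)
    fix \<phi> assume phi: "character \<phi>"
    have "\<phi> (c m - c n) = (of_real (f (\<phi> x)) - \<phi> (c n)) - (of_real (f (\<phi> x)) - \<phi> (c m))"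
      using phi c by (simp add: character_diff)
    also have "cmod \<dots> \<le> 1 / Suc n + 1 / Suc m"
      using close[OF phi, of n] close[OF phi, of m] by (intro norm_triangle_le_diff) linarith
    finally show "cmod (\<phi> (c m - c n)) \<le> 1 / Suc m + 1 / Suc n" by simp
  qed (simp_all add: closure_rules c)
  have "Cauchy c"
  proof (rule metric_CauchyI)
    fix e :: real assume "e > 0"
    then obtain N where N: "1 / Suc N < e / 2" using nat_approx_posE[of "e / 2"] by auto
    have "dist (c m) (c n) < e" if "m \<ge> N" "n \<ge> N" for m n
    proof -
      have "1 / real (Suc m) \<le> 1 / Suc N" "1 / real (Suc n) \<le> 1 / Suc N"
        using that by (auto intro!: divide_left_mono)
      then show ?thesis using diff[of m n] N unfolding dist_norm by linarith
    qed
    then show "\<exists>N. \<forall>m\<ge>N. \<forall>n\<ge>N. dist (c m) (c n) < e" by blast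
  qed
  then obtain l where l: "c \<longlonglongrightarrow> l" using Cauchy_convergent convergent_def by blast
  have lC: "l \<in> C" using closed_sequentially[OF closed_carrier _ l] c by blast
  have "\<phi> l = of_real (f (\<phi> x))" if phi: "character \<phi>" for \<phi>
  proof -
    have "(\<lambda>n. \<phi> (c n)) \<longlonglongrightarrow> \<phi> l"
    proof (rule Lim_transform_bound[where g = "\<lambda>n. c n - l", THEN LIM_zero_cancel])
      show "\<forall>\<^sub>F n in sequentially. norm (\<phi> (c n) - \<phi> l) \<le> norm (c n - l)"
        using norm_character_le[OF phi, of "c n - l" for n] c lC
        by (intro always_eventually allI) (simp add: closure_rules character_diff[OF phi])
      show "(\<lambda>n. c n - l) \<longlonglongrightarrow> 0" using l by (simp add: LIM_zero)
    qed
    moreover have "(\<lambda>n. \<phi> (c n)) \<longlonglongrightarrow> of_real (f (\<phi> x))"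
    proof (rule LIM_zero_cancel, rule Lim_null_comparison)
      show "\<forall>\<^sub>F n in sequentially. norm (\<phi> (c n) - of_real (f (\<phi> x))) \<le> 1 / Suc n"
        using close[OF phi] by (intro always_eventually allI) (simp add: norm_minus_commute less_imp_le)
      show "(\<lambda>n. 1 / real (Suc n)) \<longlonglongrightarrow> 0" by (rule LIMSEQ_inverse_real_of_nat[unfolded inverse_eq_divide])
    qed
    ultimately show ?thesis by (rule LIMSEQ_unique)
  qed
  with lC that show thesis by blast
qed

definition transform_preimage :: "'a \<Rightarrow> (complex \<Rightarrow> complex) \<Rightarrow> 'a" where
  "transform_preimage x f = (THE c. c \<in> C \<and> (\<forall>\<phi>. character \<phi> \<longrightarrow> \<phi> c = f (\<phi> x)))"

lemma transform_preimage_eqI: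
  assumes "c \<in> C" "\<And>\<phi>. character \<phi> \<Longrightarrow> \<phi> c = f (\<phi> x)"
  shows "transform_preimage x f = c"
  unfolding transform_preimage_def using assms eq_of_characters by (intro the_equality) auto

lemma transform_preimage:
  assumes x: "x \<in> C" and f: "continuous_on (spectrum x) f"
  shows "transform_preimage x f \<in> C" "\<And>\<phi>. character \<phi> \<Longrightarrow> \<phi> (transform_preimage x f) = f (\<phi> x)"
proof -
  obtain a where a: "a \<in> C" "\<And>\<phi>. character \<phi> \<Longrightarrow> \<phi> a = of_real (Re (f (\<phi> x)))"
    using ex_transform_real[OF x, of "\<lambda>z. Re (f z)"] f by (auto intro: continuous_intros)
  obtain b where b: "b \<in> C" "\<And>\<phi>. character \<phi> \<Longrightarrow> \<phi> b = of_real (Im (f (\<phi> x)))"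
    using ex_transform_real[OF x, of "\<lambda>z. Im (f z)"] f by (auto intro: continuous_intros)
  have c: "a + \<i> *\<^sub>c b \<in> C" using a b by (simp add: closure_rules)
  have phi: "\<phi> (a + \<i> *\<^sub>c b) = f (\<phi> x)" if "character \<phi>" for \<phi>
    using that a b by (simp add: character_simps closure_rules complex_eq_iff)
  have "transform_preimage x f = a + \<i> *\<^sub>c b" 
    using c phi by (rule transform_preimage_eqI)
  with c phi show "transform_preimage x f \<in> C"
    "\<And>\<phi>. character \<phi> \<Longrightarrow> \<phi> (transform_preimage x f) = f (\<phi> x)" by auto
qed

lemma functional_calculus_transform_preimage:
  assumes x: "x \<in> C"
  shows "functional_calculus x (transform_preimage x)"
  unfolding functional_calculus_def
proof (intro conjI allI impI)
  fix f g :: "complex \<Rightarrow> complex"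
  assume "\<forall>z\<in>spectrum x. f z = g z"
  then have "f (\<phi> x) = g (\<phi> x)" if "character \<phi>" for \<phi>
    using that by (auto simp: spectrum_eq_characters[OF x])
  then show "transform_preimage x f = transform_preimage x g"
    unfolding transform_preimage_def by metis
next
  note tp = transform_preimage[OF x]
  fix f g :: "complex \<Rightarrow> complex"
  assume fg: "continuous_on (spectrum x) f \<and> continuous_on (spectrum x) g"
  then show "transform_preimage x (\<lambda>z. f z + g z) = transform_preimage x f + transform_preimage x g"
    by (intro transform_preimage_eqI) (auto simp: closure_rules character_add tp)
  show "transform_preimage x (\<lambda>z. f z * g z) = transform_preimage x f * transform_preimage x g"
    using fg by (intro transform_preimage_eqI) (auto simp: closure_rules character_mult tp)
next
  note tp = transform_preimage[OF x]
  fix k and f :: "complex \<Rightarrow> complex"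
  assume f: "continuous_on (spectrum x) f"
  then show "transform_preimage x (\<lambda>z. k * f z) = k *\<^sub>c transform_preimage x f"
    by (intro transform_preimage_eqI) (auto simp: closure_rules character_cscale tp)
  show "transform_preimage x (\<lambda>z. cnj (f z)) = adj (transform_preimage x f)"
    using f by (intro transform_preimage_eqI) (auto simp: closure_rules character_adj tp)
next
  show "transform_preimage x (\<lambda>z. 1) = 1"
    by (rule transform_preimage_eqI) (auto simp: closure_rules character_one)
  show "transform_preimage x (\<lambda>z. z) = x"
    by (rule transform_preimage_eqI) (auto simp: x)
qed

end

lemma commutant_antimono: "S \<subseteq> T \<Longrightarrow> commutant T \<subseteq> commutant S"
  by (auto simp: commutant_def)

lemma subset_bicommutant: "S \<subseteq> commutant (commutant S)"
  by (auto simp: commutant_def)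

lemma adj_commutant:
  assumes "\<And>s. s \<in> S \<Longrightarrow> adj s \<in> S" "a \<in> commutant S"
  shows "adj a \<in> commutant (S :: 'a::unital_cstar_algebra set)"
proof -
  have "adj a * s = s * adj a" if "s \<in> S" for s
  proof -
    have "a * adj s = adj s * a" using assms that by (auto simp: commutant_def)
    then have "adj (a * adj s) = adj (adj s * a)" by simp
    then show ?thesis by (simp add: adj_mult)
  qed
  then show ?thesis by (simp add: commutant_def)
qed

lemma normal_bicommutant:
  fixes x :: "'a::unital_cstar_algebra"
  assumes "normal_element x"
  shows "commutative_cstar (commutant (commutant {x, adj x}))"
    and "x \<in> commutant (commutant {x, adj x})"
proof -
  let ?S = "{x, adj x}"
  have "?S \<subseteq> commutant ?S" using assms by (auto simp: commutant_def normal_element_def)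
  then have sub: "commutant (commutant ?S) \<subseteq> commutant ?S" by (rule commutant_antimono)
  show "commutative_cstar (commutant (commutant ?S))"
  proof
    fix a b assume ab: "a \<in> commutant (commutant ?S)" "b \<in> commutant (commutant ?S)"
    then have "b \<in> commutant ?S" using sub by blast
    then show "a * b = b * a" using ab(1) unfolding commutant_def by blast
  next
    show "commutant (commutant (commutant (commutant ?S))) \<subseteq> commutant (commutant ?S)"
      by (intro commutant_antimono subset_bicommutant)
  next
    fix a assume "a \<in> commutant (commutant ?S)"
    then show "adj a \<in> commutant (commutant ?S)"
      by (intro adj_commutant[OF adj_commutant]) auto
  qed
  show "x \<in> commutant (commutant ?S)" using subset_bicommutant[of ?S] by blast
qed

text \<open>
  The bicommutant of \<open>x\<close> and \<open>x\<^sup>*\<close> is commutative, so the calculus constructed there is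
  one of the candidates for the choice in the definition of \<open>cfc\<close>.
\<close>

theorem functional_calculus_cfc:
  assumes "normal_element x"
  shows "functional_calculus x (cfc x)"
  unfolding cfc_def
  using commutative_cstar.functional_calculus_transform_preimage[OF normal_bicommutant[OF assms]]
  by (rule someI[where P = "functional_calculus x"])

lemma compact_spectrum_normal: "normal_element x \<Longrightarrow> compact (spectrum x)"
  using commutative_cstar.compact_spectrum[OF normal_bicommutant] by blast

lemma self_adjoint_normal: "adj x = x \<Longrightarrow> normal_element x"
  by (simp add: normal_element_def)

lemma spectrum_self_adjoint:
  assumes "adj a = (a :: 'a::unital_cstar_algebra)" "z \<in> spectrum a"
  shows "Im z = 0"
proof -
  let ?C = "commutant (commutant {a, adj a})"
  interpret commutative_cstar ?C by (rule normal_bicommutant[OF self_adjoint_normal[OF assms(1)]])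
  have a: "a \<in> ?C" by (rule normal_bicommutant[OF self_adjoint_normal[OF assms(1)]])
  obtain \<phi> where "character \<phi>" "z = \<phi> a"
    using assms(2) spectrum_eq_characters[OF a] by blast
  then have "cnj z = z" using character_adj[OF _ a] assms(1) by simp
  then show ?thesis by (simp add: complex_eq_iff)
qed

text \<open>
  In the bicommutant of \<open>a\<close> both conditions say that every character is non-negative at \<open>a\<close>.
\<close>

lemma positive_element_iff_nonneg: "positive_element a \<longleftrightarrow> nonneg (a :: 'a::unital_cstar_algebra)"
proof (cases "adj a = a")
  case True
  let ?C = "commutant (commutant {a, adj a})"
  interpret commutative_cstar ?C by (rule normal_bicommutant[OF self_adjoint_normal[OF True]])
  have a: "a \<in> ?C" by (rule normal_bicommutant[OF self_adjoint_normal[OF True]])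
  show ?thesis
  proof
    assume "nonneg a"
    then show "positive_element a"
      using a by (auto simp: positive_element_def True spectrum_eq_characters[OF a] character_nonneg)
  next
    assume pos: "positive_element a"
    have "norm (of_real (norm a) - a) \<le> norm a"
    proof (rule norm_le_of_characters)
      fix \<phi> assume phi: "character \<phi>"
      then have "\<phi> a \<in> spectrum a" by (auto simp: spectrum_eq_characters[OF a])
      then have "\<phi> a \<in> \<real>\<^sub>\<ge>\<^sub>0" using pos by (auto simp: positive_element_def)
      then obtain r where r: "\<phi> a = of_real r" "r \<ge> 0" by (auto elim: nonneg_Reals_cases)
      moreover have "r \<le> norm a" using norm_character_le[OF phi a] r by simp
      ultimately show "cmod (\<phi> (of_real (norm a) - a)) \<le> norm a"
        using phi a by (simp add: character_diff character_of_real closure_rules flip: of_real_diff)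
    qed (simp_all add: closure_rules a)
    then show "nonneg a" using True norm_ge_zero[of a] unfolding nonneg_def by blast
  qed
next
  case False
  then show ?thesis by (simp add: positive_element_def nonneg_def)
qed

context
  fixes x :: "'a::unital_cstar_algebra" assumes x: "normal_element x"
begin

lemma cfc_cong: "(\<And>z. z \<in> spectrum x \<Longrightarrow> f z = g z) \<Longrightarrow> cfc x f = cfc x g"
  using functional_calculus_cfc[OF x] unfolding functional_calculus_def by blast

lemma cfc_add: "continuous_on (spectrum x) f \<Longrightarrow> continuous_on (spectrum x) g \<Longrightarrow>
    cfc x (\<lambda>z. f z + g z) = cfc x f + cfc x g"
  and cfc_mult: "continuous_on (spectrum x) f \<Longrightarrow> continuous_on (spectrum x) g \<Longrightarrow>
    cfc x (\<lambda>z. f z * g z) = cfc x f * cfc x g"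
  and cfc_cscale: "continuous_on (spectrum x) f \<Longrightarrow> cfc x (\<lambda>z. c * f z) = c *\<^sub>c cfc x f"
  and cfc_cnj: "continuous_on (spectrum x) f \<Longrightarrow> cfc x (\<lambda>z. cnj (f z)) = adj (cfc x f)"
  and cfc_one: "cfc x (\<lambda>z. 1) = 1"
  and cfc_id: "cfc x (\<lambda>z. z) = x"
  using functional_calculus_cfc[OF x] unfolding functional_calculus_def by blast+

lemma cfc_const: "cfc x (\<lambda>z. c) = c *\<^sub>c 1"
  using cfc_cscale[of "\<lambda>z. 1" c] by (simp add: cfc_one)

lemma cfc_real_const: "cfc_real x (\<lambda>z. r) = of_real r"
  unfolding cfc_const cscale_of_real by (rule of_real_def[symmetric])

lemma cfc_real_cong: "(\<And>z. z \<in> spectrum x \<Longrightarrow> f z = g z) \<Longrightarrow> cfc_real x f = cfc_real x g"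
  by (rule cfc_cong) simp

context
  fixes f g :: "complex \<Rightarrow> real"
  assumes f: "continuous_on (spectrum x) f" and g: "continuous_on (spectrum x) g"
begin

lemma cfc_real_add: "cfc_real x (\<lambda>z. f z + g z) = cfc_real x f + cfc_real x g"
  using cfc_add[of "\<lambda>z. of_real (f z)" "\<lambda>z. of_real (g z)"] f g by (simp add: continuous_on_of_real)

lemma cfc_real_mult: "cfc_real x (\<lambda>z. f z * g z) = cfc_real x f * cfc_real x g"
  using cfc_mult[of "\<lambda>z. of_real (f z)" "\<lambda>z. of_real (g z)"] f g by (simp add: continuous_on_of_real)

end

lemma cfc_real_scale:
  assumes f: "continuous_on (spectrum x) f"
  shows "cfc_real x (\<lambda>z. r * f z) = r *\<^sub>R cfc_real x f"
  using cfc_real_mult[OF continuous_on_const f, of r] by (simp add: cfc_real_const scaleR_conv_of_real)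

lemma cfc_real_diff:
  assumes "continuous_on (spectrum x) f" "continuous_on (spectrum x) g"
  shows "cfc_real x (\<lambda>z. f z - g z) = cfc_real x f - cfc_real x g"
  using cfc_real_add[of "\<lambda>z. f z - g z" g] assms by (simp add: continuous_on_diff)

lemma cfc_real_adj: "continuous_on (spectrum x) f \<Longrightarrow> adj (cfc_real x f) = cfc_real x f"
  using cfc_cnj[of "\<lambda>z. of_real (f z)"] by (simp add: continuous_on_of_real)

lemma cfc_real_nonneg:
  assumes f: "continuous_on (spectrum x) f" "\<And>z. z \<in> spectrum x \<Longrightarrow> 0 \<le> f z"
  shows "nonneg (cfc_real x f)"
proof -
  have c: "continuous_on (spectrum x) (\<lambda>z. sqrt (f z))" using f by (intro continuous_intros)
  have "cfc_real x f = cfc_real x (\<lambda>z. sqrt (f z) * sqrt (f z))" using f by (intro cfc_real_cong) simp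
  also have "\<dots> = cfc_real x (\<lambda>z. sqrt (f z)) * cfc_real x (\<lambda>z. sqrt (f z))" by (rule cfc_real_mult[OF c c])
  finally show ?thesis using nonneg_square[OF cfc_real_adj[OF c]] by simp
qed

lemma cfc_real_mono:
  assumes "continuous_on (spectrum x) f" "continuous_on (spectrum x) g"
    "\<And>z. z \<in> spectrum x \<Longrightarrow> f z \<le> g z"
  shows "nonneg (cfc_real x g - cfc_real x f)"
  unfolding cfc_real_diff[OF assms(2,1), symmetric]
  using assms by (intro cfc_real_nonneg continuous_on_diff) auto

lemma norm_cfc_real_le:
  assumes f: "continuous_on (spectrum x) f" "\<And>z. z \<in> spectrum x \<Longrightarrow> 0 \<le> f z \<and> f z \<le> K" and "K \<ge> 0"
  shows "norm (cfc_real x f) \<le> K"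
  using cfc_real_nonneg[OF f(1)] cfc_real_mono[OF f(1) continuous_on_const, of K] assms
  by (intro norm_le_of_nonneg) (simp_all add: cfc_real_const)

lemma cfc_real_distance_square:
  "cfc_real x (\<lambda>z. (cmod (z - \<mu>))\<^sup>2) = adj (x - \<mu> *\<^sub>c 1) * (x - \<mu> *\<^sub>c 1)"
proof -
  have c: "continuous_on (spectrum x) (\<lambda>z. z - \<mu>)" by (intro continuous_intros)
  have 1: "cfc x (\<lambda>z. z - \<mu>) = x - \<mu> *\<^sub>c 1"
    using cfc_add[of "\<lambda>z. z" "\<lambda>z. - \<mu>"] by (simp add: cfc_id cfc_const continuous_on_const)
  have 2: "cfc x (\<lambda>z. cnj (z - \<mu>) * (z - \<mu>)) = cfc x (\<lambda>z. cnj (z - \<mu>)) * cfc x (\<lambda>z. z - \<mu>)"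
    using c by (intro cfc_mult continuous_intros)
  have "cfc_real x (\<lambda>z. (cmod (z - \<mu>))\<^sup>2) = cfc x (\<lambda>z. cnj (z - \<mu>) * (z - \<mu>))"
    by (simp only: complex_norm_square mult.commute)
  then show ?thesis by (simp only: 1 2 cfc_cnj[OF c])
qed

end

section \<open>The order of the algebra\<close>

lemma spectrum_nonneg: "nonneg b \<Longrightarrow> z \<in> spectrum b \<Longrightarrow> 0 \<le> Re z"
  by (auto simp flip: positive_element_iff_nonneg simp: positive_element_def complex_nonneg_Reals_iff)

lemma nonneg_normal: "nonneg b \<Longrightarrow> normal_element b"
  by (simp add: nonneg_adj self_adjoint_normal)

lemma cfc_real_Re:
  assumes "adj b = (b :: 'a::unital_cstar_algebra)"
  shows "cfc_real b Re = b"
proof -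
  have "cfc_real b Re = cfc b (\<lambda>z. z)"
    using spectrum_self_adjoint[OF assms]
    by (intro cfc_cong[OF self_adjoint_normal[OF assms]]) (simp add: complex_eq_iff)
  then show ?thesis by (simp add: cfc_id[OF self_adjoint_normal[OF assms]])
qed

lemma spectrum_uminus: "z \<in> spectrum (- a) \<longleftrightarrow> - z \<in> spectrum (a :: 'a::unital_cstar_algebra)"
proof -
  have inv: "invertible_element (- c)" if c: "invertible_element c" for c :: 'a
  proof -
    obtain d where "c * d = 1" "d * c = 1" using c by (auto simp: invertible_element_def)
    then have "- c * - d = 1" "- d * - c = 1" by simp_all
    then show ?thesis unfolding invertible_element_def by blast
  qed
  have "invertible_element (- c) \<longleftrightarrow> invertible_element c" for c :: 'a
    using inv[of c] inv[of "- c"] by auto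
  moreover have "z *\<^sub>c 1 - (- a) = - ((- z) *\<^sub>c 1 - a)" by simp
  ultimately show ?thesis unfolding spectrum_def by (metis mem_Collect_eq)
qed

text \<open>
  If \<open>d\<close> inverts \<open>z - ba\<close>, then \<open>z\<^sup>-\<^sup>1(1 + adb)\<close> inverts \<open>z - ab\<close>.
\<close>

lemma spectrum_mult_commute:
  fixes a b :: "'a::unital_cstar_algebra"
  assumes "z \<in> spectrum (a * b)" "z \<noteq> 0"
  shows "z \<in> spectrum (b * a)"
proof (rule ccontr)
  assume "z \<notin> spectrum (b * a)"
  then obtain d where d: "(z *\<^sub>c 1 - b * a) * d = 1" "d * (z *\<^sub>c 1 - b * a) = 1"
    by (auto simp: spectrum_def invertible_element_def)
  have d1: "b * a * d = z *\<^sub>c d - 1" and d2: "d * b * a = z *\<^sub>c d - 1"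
    using d by (simp_all add: algebra_simps mult_cscale_left mult_cscale_right)
  let ?e = "inverse z *\<^sub>c (1 + a * d * b)"
  have "(z *\<^sub>c 1 - a * b) * (1 + a * d * b) = z *\<^sub>c 1 + z *\<^sub>c (a * d * b) - a * b - a * (b * a * d) * b"
    by (simp add: algebra_simps mult_cscale_left cscale_add_right)
  also have "\<dots> = z *\<^sub>c 1" unfolding d1 by (simp add: algebra_simps mult_cscale_left mult_cscale_right)
  finally have 1: "(z *\<^sub>c 1 - a * b) * ?e = 1"
    using assms(2) by (simp add: mult_cscale_right cscale_cscale cscale_one)
  have "(1 + a * d * b) * (z *\<^sub>c 1 - a * b) = z *\<^sub>c 1 + z *\<^sub>c (a * d * b) - a * b - a * (d * b * a) * b"
    by (simp add: algebra_simps mult_cscale_right)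
  also have "\<dots> = z *\<^sub>c 1" unfolding d2 by (simp add: algebra_simps mult_cscale_left mult_cscale_right)
  finally have 2: "?e * (z *\<^sub>c 1 - a * b) = 1"
    using assms(2) by (simp add: mult_cscale_left cscale_cscale cscale_one)
  from 1 2 assms(1) show False unfolding spectrum_def invertible_element_def by blast
qed

text \<open>
  Let \<open>q\<close> be the negative part of \<open>x\<^sup>*x\<close> and \<open>y = xq\<close>, so that \<open>y\<^sup>*y = -q\<^sup>3\<close>.  As \<open>y\<^sup>*y + yy\<^sup>*\<close> is
  non-negative, so is \<open>yy\<^sup>*\<close>.  Up to \<open>0\<close> the two products have the same spectrum, which is thus
  both non-negative and non-positive; hence \<open>y = 0\<close> and \<open>q = 0\<close>.
\<close>

theorem nonneg_adj_mult: "nonneg (adj x * (x :: 'a::unital_cstar_algebra))"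
proof -
  define h where "h = adj x * x"
  have h: "adj h = h" by (simp add: h_def adj_mult)
  note N = self_adjoint_normal[OF h]
  define p where "p = cfc_real h (\<lambda>z. max 0 (Re z))"
  define q where "q = cfc_real h (\<lambda>z. max 0 (- Re z))"
  have cont: "continuous_on (spectrum h) (\<lambda>z. max 0 (Re z))" "continuous_on (spectrum h) (\<lambda>z. max 0 (- Re z))"
    by (intro continuous_intros)+
  have pn: "nonneg p" and qn: "nonneg q"
    unfolding p_def q_def by (intro cfc_real_nonneg N cont; simp)+
  have "p - q = cfc_real h (\<lambda>z. max 0 (Re z) - max 0 (- Re z))"
    unfolding p_def q_def by (rule cfc_real_diff[OF N cont, symmetric])
  also have "\<dots> = cfc_real h Re" by (intro cfc_real_cong N) simp
  finally have hpq: "h = p - q" by (simp add: cfc_real_Re h)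
  have "q * p = cfc_real h (\<lambda>z. max 0 (- Re z) * max 0 (Re z))"
    unfolding p_def q_def by (rule cfc_real_mult[OF N cont(2,1), symmetric])
  also have "\<dots> = cfc_real h (\<lambda>z. 0)" by (intro cfc_real_cong N) (auto simp: max_def)
  finally have qp: "q * p = 0" using cfc_real_const[OF N, of 0] by simp
  define y where "y = x * q"
  have "adj y * y = q * h * q" by (simp add: y_def adj_mult nonneg_adj[OF qn] h_def mult.assoc)
  then have yy: "adj y * y = - (q * q * q)" unfolding hpq by (simp add: algebra_simps qp flip: mult.assoc)
  have q3: "nonneg (q * q * q)"
    using nonneg_mult[OF nonneg_mult[OF qn qn] qn] by (simp add: mult.assoc)
  have "y * adj y = (adj y * y + y * adj y) + q * q * q"
    by (simp add: yy)
  then have pos: "nonneg (y * adj y)" using nonneg_add[OF nonneg_adj_mult_add q3] by metis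
  have "z = 0" if z: "z \<in> spectrum (adj y * y)" for z
  proof (rule ccontr)
    assume "z \<noteq> 0"
    have "Re z \<ge> 0" using spectrum_nonneg[OF pos] spectrum_mult_commute[OF z \<open>z \<noteq> 0\<close>] by blast
    moreover have "- z \<in> spectrum (q * q * q)" using z by (simp add: yy spectrum_uminus)
    then have "Re (- z) \<ge> 0" using spectrum_nonneg[OF q3] by blast
    moreover have "Im z = 0" using z by (intro spectrum_self_adjoint[of "adj y * y"]) (simp_all add: adj_mult)
    ultimately show False using \<open>z \<noteq> 0\<close> by (simp add: complex_eq_iff)
  qed
  then have "cfc (adj y * y) (\<lambda>z. z) = cfc (adj y * y) (\<lambda>z. 0)"
    by (intro cfc_cong self_adjoint_normal) (simp_all add: adj_mult)
  moreover have "normal_element (adj y * y)" by (intro self_adjoint_normal) (simp add: adj_mult)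
  ultimately have "adj y * y = 0" by (simp add: cfc_id cfc_const)
  then have "q * q * q = 0" using yy by simp
  then have "adj (q * q) * (q * q) = 0" by (simp add: adj_mult nonneg_adj[OF qn] flip: mult.assoc)
  then have "q * q = 0" using cstar_identity[of "q * q"] by simp
  then have "q = 0" using cstar_identity[of q] by (simp add: nonneg_adj[OF qn])
  then have "h = p" using hpq by simp
  then show ?thesis using pn by (simp add: h_def)
qed

lemma nonneg_conj:
  assumes "nonneg a"
  shows "nonneg (adj c * a * (c :: 'a::unital_cstar_algebra))"
proof -
  obtain v where v: "adj v = v" "v * v = a" using nonneg_sqrt[OF assms] by metis
  then have "adj c * a * c = adj (v * c) * (v * c)" by (simp add: adj_mult mult.assoc flip: v(2))
  then show ?thesis by (simp add: nonneg_adj_mult)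
qed

lemma nonneg_trans: "nonneg (b - a) \<Longrightarrow> nonneg (c - b) \<Longrightarrow> nonneg (c - (a :: 'a::unital_cstar_algebra))"
  using nonneg_add[of "b - a" "c - b"] by simp

section \<open>Approximating the support of a non-negative element\<close>

text \<open>
  The element \<open>S\<close> is \<open>(b + \<kappa>)\<^sup>-\<^sup>1\<^sup>/\<^sup>2\<close>.
\<close>

lemma resolvent_root:
  fixes b :: "'a::unital_cstar_algebra"
  assumes b: "nonneg b" and k: "\<kappa> > 0"
  obtains S where "adj S = S" "S * b = b * S" "S * S * (b + of_real \<kappa>) = 1"
proof -
  note N = nonneg_normal[OF b]
  have pos: "0 < Re z + \<kappa>" if "z \<in> spectrum b" for z
    using spectrum_nonneg[OF b that] k by simp
  define s where "s z = 1 / sqrt (Re z + \<kappa>)" for z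
  have s: "continuous_on (spectrum b) s"
    unfolding s_def using pos by (intro continuous_intros) fastforce
  have r: "continuous_on (spectrum b) Re" "continuous_on (spectrum b) (\<lambda>z. Re z + \<kappa>)" "continuous_on (spectrum b) (\<lambda>z. s z * s z)"
    using s by (intro continuous_intros; assumption?)+
  define S where "S = cfc_real b s"
  have bR: "cfc_real b Re = b" by (rule cfc_real_Re[OF nonneg_adj[OF b]])
  have "S * S = cfc_real b (\<lambda>z. s z * s z)" unfolding S_def by (rule cfc_real_mult[OF N s s, symmetric])
  moreover have "b + of_real \<kappa> = cfc_real b (\<lambda>z. Re z + \<kappa>)"
    using cfc_real_add[OF N r(1) continuous_on_const, of \<kappa>] by (simp add: bR cfc_real_const[OF N])
  ultimately have "S * S * (b + of_real \<kappa>) = cfc_real b (\<lambda>z. s z * s z * (Re z + \<kappa>))"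
    using cfc_real_mult[OF N r(3,2)] by simp
  also have "\<dots> = cfc_real b (\<lambda>z. 1)"
  proof (intro cfc_real_cong N)
    fix z assume "z \<in> spectrum b"
    then show "s z * s z * (Re z + \<kappa>) = 1" using pos[of z] by (simp add: s_def)
  qed
  finally have "S * S * (b + of_real \<kappa>) = 1" using cfc_real_const[OF N, of 1] by simp
  moreover have "S * b = b * S"
    using cfc_real_mult[OF N s r(1)] cfc_real_mult[OF N r(1) s] by (simp add: S_def bR mult.commute)
  moreover have "adj S = S" unfolding S_def by (rule cfc_real_adj[OF N s])
  ultimately show thesis using that by blast
qed

lemma resolvent_root_inverse:
  assumes "S * b = b * (S :: 'a::unital_cstar_algebra)" "S * S * (b + of_real \<kappa>) = 1"
  shows "(b + of_real \<kappa>) * (S * S) = 1" "S * (b + of_real \<kappa>) * S = 1"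
proof -
  have "S * (b + of_real \<kappa>) = (b + of_real \<kappa>) * S" using assms(1) by (simp add: algebra_simps of_real_central)
  with assms(2) show "(b + of_real \<kappa>) * (S * S) = 1" "S * (b + of_real \<kappa>) * S = 1" by (metis mult.assoc)+
qed

text \<open>
  This is \<open>b(b + \<kappa>)\<^sup>-\<^sup>1\<close>, which increases to the support of \<open>b\<close> as \<open>\<kappa>\<close> tends to \<open>0\<close>.  Compared
  with \<open>f\<^sub>\<epsilon>(b)\<close> it has two advantages: it is monotone in \<open>b\<close>, and
  its values at \<open>X\<^sup>*X\<close> and \<open>XX\<^sup>*\<close> are related by an algebraic identity.
\<close>

definition support_approx :: "real \<Rightarrow> 'a::unital_cstar_algebra \<Rightarrow> 'a" where
  "support_approx \<kappa> b = cfc_real b (\<lambda>z. Re z / (Re z + \<kappa>))"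

lemma support_approx_eqI:
  assumes b: "nonneg b" and k: "\<kappa> > 0" and c: "c * (b + of_real \<kappa>) = b"
  shows "support_approx \<kappa> b = c"
proof -
  note N = nonneg_normal[OF b]
  have pos: "0 < Re z + \<kappa>" if "z \<in> spectrum b" for z
    using spectrum_nonneg[OF b that] k by simp
  have r: "continuous_on (spectrum b) Re" "continuous_on (spectrum b) (\<lambda>z. Re z + \<kappa>)"
    "continuous_on (spectrum b) (\<lambda>z. Re z / (Re z + \<kappa>))"
    using pos by (intro continuous_intros; fastforce?)+
  have bR: "cfc_real b Re = b" by (rule cfc_real_Re[OF nonneg_adj[OF b]])
  have "support_approx \<kappa> b * (b + of_real \<kappa>) = cfc_real b (\<lambda>z. Re z / (Re z + \<kappa>)) * cfc_real b (\<lambda>z. Re z + \<kappa>)"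
    using cfc_real_add[OF N r(1) continuous_on_const, of \<kappa>]
    by (simp add: bR cfc_real_const[OF N] support_approx_def)
  also have "\<dots> = cfc_real b (\<lambda>z. Re z / (Re z + \<kappa>) * (Re z + \<kappa>))"
    by (rule cfc_real_mult[OF N r(3,2), symmetric])
  also have "\<dots> = cfc_real b Re" using pos by (intro cfc_real_cong N) fastforce
  finally have "support_approx \<kappa> b * (b + of_real \<kappa>) = c * (b + of_real \<kappa>)" by (simp add: c bR)
  moreover obtain S where S: "adj S = S" "S * b = b * S" "S * S * (b + of_real \<kappa>) = 1"
    using resolvent_root[OF b k] .
  ultimately show ?thesis
    using resolvent_root_inverse(1)[OF S(2,3)] by (metis mult.assoc mult_1_right)
qed

text \<open>
  The claim is \<open>(b + \<kappa>)\<^sup>-\<^sup>1 \<le> (a + \<kappa>)\<^sup>-\<^sup>1\<close>.  For \<open>Y = (b + \<kappa>)\<^sup>-\<^sup>1\<^sup>/\<^sup>2(a + \<kappa>)\<^sup>1\<^sup>/\<^sup>2\<close> the hypothesis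
  says \<open>YY\<^sup>* \<le> 1\<close>, the claim says \<open>Y\<^sup>*Y \<le> 1\<close>, and both mean \<open>\<parallel>Y\<parallel> \<le> 1\<close>.
\<close>

lemma support_approx_mono:
  fixes a b :: "'a::unital_cstar_algebra"
  assumes a: "nonneg a" and ab: "nonneg (b - a)" and k: "\<kappa> > 0"
  shows "nonneg (support_approx \<kappa> b - support_approx \<kappa> a)"
proof -
  have b: "nonneg b" using nonneg_add[OF a ab] by simp
  obtain T where T: "adj T = T" "T * a = a * T" "T * T * (a + of_real \<kappa>) = 1"
    using resolvent_root[OF a k] .
  obtain S where S: "adj S = S" "S * b = b * S" "S * S * (b + of_real \<kappa>) = 1"
    using resolvent_root[OF b k] .
  have rho: "support_approx \<kappa> c = 1 - of_real \<kappa> * (R * R)"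
    if "nonneg c" "R * R * (c + of_real \<kappa>) = 1" for c R :: 'a
    using that(2) by (intro support_approx_eqI that(1) k) (simp add: left_diff_distrib mult.assoc)
  define U where "U = T * (a + of_real \<kappa>)"
  have Tc: "T * (a + of_real \<kappa>) = (a + of_real \<kappa>) * T" using T(2) by (simp add: algebra_simps of_real_central)
  have U: "adj U = U" using Tc T(1) by (simp add: U_def adj_mult nonneg_adj[OF a])
  have TU: "T * U = 1" "U * T = 1" and UU: "U * U = a + of_real \<kappa>"
    using T(3) Tc unfolding U_def by (metis mult.assoc mult_1_left)+
  define Y where "Y = S * U"
  have "1 - Y * adj Y = S * (b + of_real \<kappa>) * S - S * (U * U) * S"
    unfolding resolvent_root_inverse(2)[OF S(2,3)] by (simp add: Y_def adj_mult U S(1) mult.assoc)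
  also have "\<dots> = adj S * (b - a) * S" unfolding UU by (simp add: algebra_simps S(1))
  finally have "nonneg (of_real 1 - Y * adj Y)" using nonneg_conj[OF ab] by simp
  moreover have "nonneg (Y * adj Y)" using nonneg_adj_mult[of "adj Y"] by simp
  ultimately have "norm (Y * adj Y) \<le> 1" by (intro norm_le_of_nonneg) auto
  then have "norm (adj Y * Y) \<le> 1" by (simp add: norm_sq cstar_identity)
  then have "nonneg (of_real 1 - adj Y * Y)" by (intro nonneg_norm_diff) (simp_all add: adj_mult)
  then have "nonneg (adj T * (of_real 1 - adj Y * Y) * T)" by (rule nonneg_conj)
  also have "adj T * (of_real 1 - adj Y * Y) * T = T * T - (T * U) * (S * S) * (U * T)"
    by (simp add: Y_def adj_mult U S(1) T(1) algebra_simps)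
  finally have "nonneg (\<kappa> *\<^sub>R (T * T - S * S))" using k by (intro nonneg_scaleR) (simp_all add: TU)
  also have "\<kappa> *\<^sub>R (T * T - S * S) = support_approx \<kappa> b - support_approx \<kappa> a"
    by (simp add: rho[OF a T(3)] rho[OF b S(3)] scaleR_conv_of_real right_diff_distrib)
  finally show ?thesis .
qed

lemma support_approx_cfc_real:
  fixes x :: "'a::unital_cstar_algebra"
  assumes x: "normal_element x" and f: "continuous_on (spectrum x) f" "\<And>z. z \<in> spectrum x \<Longrightarrow> 0 \<le> f z"
    and k: "\<kappa> > 0"
  shows "support_approx \<kappa> (cfc_real x f) = cfc_real x (\<lambda>z. f z / (f z + \<kappa>))"
proof (rule support_approx_eqI[OF cfc_real_nonneg[OF x f] k])
  have pos: "0 < f z + \<kappa>" if "z \<in> spectrum x" for z using f(2)[OF that] k by simp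
  have c: "continuous_on (spectrum x) (\<lambda>z. f z + \<kappa>)" "continuous_on (spectrum x) (\<lambda>z. f z / (f z + \<kappa>))"
    using pos f(1) by (intro continuous_intros; fastforce?)+
  have "cfc_real x (\<lambda>z. f z / (f z + \<kappa>)) * (cfc_real x f + of_real \<kappa>) =
      cfc_real x (\<lambda>z. f z / (f z + \<kappa>)) * cfc_real x (\<lambda>z. f z + \<kappa>)"
    by (simp only: cfc_real_add[OF x f(1) continuous_on_const] cfc_real_const[OF x])
  also have "\<dots> = cfc_real x (\<lambda>z. f z / (f z + \<kappa>) * (f z + \<kappa>))" by (rule cfc_real_mult[OF x c(2,1), symmetric])
  also have "\<dots> = cfc_real x f" using pos by (intro cfc_real_cong x) fastforce
  finally show "cfc_real x (\<lambda>z. f z / (f z + \<kappa>)) * (cfc_real x f + of_real \<kappa>) = cfc_real x f" .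
qed

text \<open>
  With \<open>R = (X\<^sup>*X + \<kappa>)\<^sup>-\<^sup>1\<close> this is the identity \<open>XRX\<^sup>* = XX\<^sup>*(XX\<^sup>* + \<kappa>)\<^sup>-\<^sup>1\<close>.  The two values are written as
  products of the same two factors in opposite order, so that a trace does not
  distinguish them.
\<close>

lemma support_approx_swap:
  fixes X :: "'a::unital_cstar_algebra"
  assumes "\<kappa> > 0"
  obtains R where "support_approx \<kappa> (adj X * X) = (R * adj X) * X"
    "support_approx \<kappa> (X * adj X) = X * (R * adj X)"
proof -
  let ?b = "adj X * X"
  obtain S where S: "adj S = S" "S * ?b = ?b * S" "S * S * (?b + of_real \<kappa>) = 1"
    using resolvent_root[OF nonneg_adj_mult assms] .
  define R where "R = S * S"
  have R: "R * (?b + of_real \<kappa>) = 1" by (simp add: R_def S(3))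
  have comm: "?b * (?b + of_real \<kappa>) = (?b + of_real \<kappa>) * ?b" by (simp add: algebra_simps of_real_central)
  have "(R * adj X) * X * (?b + of_real \<kappa>) = R * (?b + of_real \<kappa>) * ?b"
    using comm by (simp add: mult.assoc)
  then have 1: "support_approx \<kappa> ?b = (R * adj X) * X"
    using R by (intro support_approx_eqI nonneg_adj_mult assms) simp
  have nn: "nonneg (X * adj X)" using nonneg_adj_mult[of "adj X"] by simp
  have "X * (R * adj X) * (X * adj X + of_real \<kappa>) = X * (R * (?b + of_real \<kappa>)) * adj X"
    by (simp add: algebra_simps of_real_central)
  then have "support_approx \<kappa> (X * adj X) = X * (R * adj X)"
    using R by (intro support_approx_eqI nn assms) simp
  with 1 show thesis using that by blast
qed

text \<open>
  Where \<open>f\<close> is less than \<open>\<eta>\<close> there is nothing to prove; the rest of \<open>K\<close> is compact, so that \<open>f\<close> is bounded and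
  \<open>g\<close> is bounded away from \<open>0\<close> there.  The expression bounded here is the error of \<open>f \<cdot> g/(g + \<kappa>)\<close> as an approximation of
  \<open>f\<close>.
\<close>

lemma compact_support_bound:
  fixes f g :: "complex \<Rightarrow> real"
  assumes K: "compact K" and f: "continuous_on K f" and g: "continuous_on K g"
    and nn: "\<And>z. z \<in> K \<Longrightarrow> 0 \<le> f z \<and> 0 \<le> g z"
    and supp: "\<And>z. z \<in> K \<Longrightarrow> 0 < f z \<Longrightarrow> 0 < g z" and \<eta>: "\<eta> > 0"
  obtains \<kappa> where "\<kappa> > 0" "\<forall>z\<in>K. f z * \<kappa> / (g z + \<kappa>) \<le> \<eta>"
proof -
  define L where "L = K \<inter> f -` {\<eta>..}"
  have small: "f z * \<kappa> / (g z + \<kappa>) \<le> \<eta>" if "z \<in> K" "z \<notin> L" "\<kappa> > 0" for z \<kappa>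
  proof -
    have "f z * (\<kappa> / (g z + \<kappa>)) \<le> f z * 1"
      using nn[OF that(1)] that(3) by (intro mult_left_mono) auto
    then show ?thesis using that by (auto simp: L_def)
  qed
  show thesis
  proof (cases "L = {}")
    case True
    then show thesis using small[where \<kappa> = 1] that[of 1] by auto
  next
    case False
    have "closed L" unfolding L_def
      using continuous_closed_preimage[OF f compact_imp_closed[OF K]] by simp
    then have "compact (K \<inter> L)" by (rule compact_Int_closed[OF K])
    then have L: "compact L" by (simp add: L_def Int_absorb1 Int_left_absorb)
    have LK: "L \<subseteq> K" by (auto simp: L_def)
    obtain z0 where z0: "z0 \<in> L" "\<And>z. z \<in> L \<Longrightarrow> g z0 \<le> g z"
      using continuous_attains_inf[OF L False continuous_on_subset[OF g LK]] by blast
    obtain z1 where z1: "z1 \<in> L" "\<And>z. z \<in> L \<Longrightarrow> f z \<le> f z1"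
      using continuous_attains_sup[OF L False continuous_on_subset[OF f LK]] by blast
    have M: "f z1 > 0" using z1 \<eta> by (auto simp: L_def)
    have m: "g z0 > 0" using z0 supp[of z0] \<eta> by (auto simp: L_def)
    define \<kappa> where "\<kappa> = \<eta> * g z0 / f z1"
    have k: "\<kappa> > 0" using M m \<eta> by (simp add: \<kappa>_def)
    have "f z * \<kappa> / (g z + \<kappa>) \<le> \<eta>" if z: "z \<in> K" for z
    proof (cases "z \<in> L")
      case True
      have "f z * \<kappa> / (g z + \<kappa>) \<le> f z1 * \<kappa> / g z0"
        using z0(2)[OF True] z1(2)[OF True] nn[OF z] m k by (intro frac_le mult_mono) auto
      also have "\<dots> = \<eta>" using M m by (simp add: \<kappa>_def)
      finally show ?thesis .
    qed (rule small[OF z _ k])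
    then show thesis using k that by blast
  qed
qed

section \<open>Tracial states\<close>

lemma f_eps_eq: "\<epsilon> > 0 \<Longrightarrow> f_eps \<epsilon> t = max 0 (min 1 (2 * t / \<epsilon> - 1))"
  by (auto simp: f_eps_def max_def min_def field_simps)

lemma continuous_on_f_eps: "\<epsilon> > 0 \<Longrightarrow> continuous_on S (\<lambda>z. f_eps \<epsilon> (Re z))"
  by (simp add: f_eps_eq) (intro continuous_intros, simp)

context
  fixes \<tau> :: "'a::unital_cstar_algebra \<Rightarrow> complex"
  assumes \<tau>: "\<tau> \<in> tracial_states"
begin

lemma trace_add: "\<tau> (a + b) = \<tau> a + \<tau> b"
  and trace_cscale: "\<tau> (c *\<^sub>c a) = c * \<tau> a"
  and trace_one: "\<tau> 1 = 1"
  and trace_commute: "\<tau> (a * b) = \<tau> (b * a)"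
  using \<tau> by (auto simp: tracial_states_def Vector_Spaces.linear_iff)

lemma trace_scaleR: "\<tau> (r *\<^sub>R a) = of_real r * \<tau> a"
  using trace_cscale[of "of_real r" a] by (simp add: cscale_of_real)

lemma trace_of_real: "\<tau> (of_real r) = of_real r"
  unfolding of_real_def[where 'a = 'a] trace_scaleR trace_one by simp

lemma trace_mono:
  assumes "nonneg (b - a)"
  shows "Re (\<tau> a) \<le> Re (\<tau> b)"
proof -
  have "\<tau> (b - a) \<in> \<real>\<^sub>\<ge>\<^sub>0"
    using \<tau> assms by (auto simp: tracial_states_def positive_element_iff_nonneg)
  then show ?thesis using trace_add[of "b - a" a] by (simp add: complex_nonneg_Reals_iff)
qed

context
  fixes b :: 'a
  assumes b: "nonneg b"
begin

lemma continuous_on_support_approx: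
  assumes "\<kappa> > 0"
  shows "continuous_on (spectrum b) (\<lambda>z. Re z / (Re z + \<kappa>))"
  using spectrum_nonneg[OF b] assms by (intro continuous_intros) fastforce

text \<open>
  The values \<open>\<tau>(f\<^sub>\<epsilon>(b))\<close> increase as \<open>\<epsilon>\<close> decreases and are at most \<open>1\<close>, so the limit exists and is a
  supremum.
\<close>

lemma d_tau_eq_SUP:
  defines "T \<equiv> \<lambda>\<epsilon>. Re (\<tau> (cfc_real b (\<lambda>z. f_eps \<epsilon> (Re z))))"
  shows "d_tau \<tau> b = (SUP \<epsilon>\<in>{0<..}. T \<epsilon>)" and "bdd_above (T ` {0<..})"
proof -
  note N = nonneg_normal[OF b]
  have le1: "T \<epsilon> \<le> 1" if "\<epsilon> > 0" for \<epsilon>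
  proof -
    have "T \<epsilon> \<le> Re (\<tau> (cfc_real b (\<lambda>z. 1)))"
      unfolding T_def
      by (intro trace_mono cfc_real_mono N continuous_on_f_eps that continuous_intros) (simp add: f_eps_eq that)
    then show ?thesis using cfc_real_const[OF N, of 1] by (simp add: trace_one)
  qed
  then show bdd: "bdd_above (T ` {0<..})" by (auto intro!: bdd_aboveI[of _ 1])
  have anti: "T \<epsilon> \<le> T \<delta>" if "0 < \<delta>" "\<delta> \<le> \<epsilon>" for \<delta> \<epsilon>
    unfolding T_def
  proof (intro trace_mono cfc_real_mono N continuous_on_f_eps)
    fix z assume "z \<in> spectrum b"
    then have "2 * Re z / \<epsilon> \<le> 2 * Re z / \<delta>"
      using spectrum_nonneg[OF b] that by (intro divide_left_mono) auto
    then show "f_eps \<epsilon> (Re z) \<le> f_eps \<delta> (Re z)" using that by (simp add: f_eps_eq max_def min_def)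
  qed (use that in auto)
  have "(T \<longlongrightarrow> (SUP \<epsilon>\<in>{0<..}. T \<epsilon>)) (at_right 0)"
  proof (rule order_tendstoI)
    fix l assume "l < (SUP \<epsilon>\<in>{0<..}. T \<epsilon>)"
    then obtain \<delta> where \<delta>: "\<delta> > 0" "l < T \<delta>"
      using less_cSUP_iff[OF _ bdd] by auto
    have "l < T \<epsilon>" if "0 < \<epsilon>" "\<epsilon> < \<delta>" for \<epsilon> using \<delta> anti[of \<epsilon> \<delta>] that by simp
    then show "\<forall>\<^sub>F \<epsilon> in at_right 0. l < T \<epsilon>"
      unfolding eventually_at_right_field using \<delta>(1) by blast
  next
    fix u assume u: "(SUP \<epsilon>\<in>{0<..}. T \<epsilon>) < u"
    have "T \<epsilon> < u" if "0 < \<epsilon>" for \<epsilon> using cSUP_upper[OF _ bdd, of \<epsilon>] that u by simp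
    then show "\<forall>\<^sub>F \<epsilon> in at_right 0. T \<epsilon> < u"
      unfolding eventually_at_right_field by (intro exI[of _ 1]) auto
  qed
  then show "d_tau \<tau> b = (SUP \<epsilon>\<in>{0<..}. T \<epsilon>)"
    unfolding d_tau_def T_def by (intro tendsto_Lim) auto
qed

text \<open>
  This lemma and the next one express \<open>d\<^sub>\<tau>(b)\<close> as the supremum of \<open>\<tau>(b(b + \<kappa>)\<^sup>-\<^sup>1)\<close>.  The first uses
  \<open>t/(t + \<kappa>) \<le> f\<^sub>\<epsilon>(t) + \<epsilon>/\<kappa>\<close>, the second \<open>f\<^sub>\<epsilon>(t) \<le> (1 + 2\<kappa>/\<epsilon>) \<cdot> t/(t + \<kappa>)\<close>.
\<close>

lemma d_tau_ge:
  assumes k: "\<kappa> > 0"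
  shows "Re (\<tau> (support_approx \<kappa> b)) \<le> d_tau \<tau> b"
proof (rule field_le_epsilon)
  note N = nonneg_normal[OF b]
  fix e :: real assume e: "e > 0"
  define \<epsilon> where "\<epsilon> = e * \<kappa>"
  have eps: "\<epsilon> > 0" using e k by (simp add: \<epsilon>_def)
  have "Re (\<tau> (support_approx \<kappa> b)) \<le> Re (\<tau> (cfc_real b (\<lambda>z. f_eps \<epsilon> (Re z) + e)))"
    unfolding support_approx_def
  proof (intro trace_mono cfc_real_mono N continuous_on_support_approx k continuous_on_add
      continuous_on_const continuous_on_f_eps eps)
    fix z assume "z \<in> spectrum b"
    then have z: "Re z \<ge> 0" by (rule spectrum_nonneg[OF b])
    show "Re z / (Re z + \<kappa>) \<le> f_eps \<epsilon> (Re z) + e"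
    proof (cases "Re z \<ge> \<epsilon>")
      case True
      then have "f_eps \<epsilon> (Re z) = 1" using eps by (simp add: f_eps_def)
      moreover have "Re z / (Re z + \<kappa>) \<le> 1" using z k by simp
      ultimately show ?thesis using e by simp
    next
      case False
      have "Re z / (Re z + \<kappa>) \<le> Re z / \<kappa>" using z k by (intro divide_left_mono) auto
      also have "\<dots> \<le> e" using False k by (simp add: \<epsilon>_def field_simps)
      finally show ?thesis using eps by (simp add: f_eps_eq)
    qed
  qed
  also have "\<dots> = Re (\<tau> (cfc_real b (\<lambda>z. f_eps \<epsilon> (Re z)))) + e"
    unfolding cfc_real_add[OF N continuous_on_f_eps[OF eps] continuous_on_const] cfc_real_const[OF N]
    by (simp add: trace_add trace_of_real)
  also have "\<dots> \<le> d_tau \<tau> b + e"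
    unfolding d_tau_eq_SUP(1) using eps by (intro add_right_mono cSUP_upper d_tau_eq_SUP(2)) simp
  finally show "Re (\<tau> (support_approx \<kappa> b)) \<le> d_tau \<tau> b + e" .
qed

lemma d_tau_le:
  assumes L: "\<And>\<kappa>. \<kappa> > 0 \<Longrightarrow> Re (\<tau> (support_approx \<kappa> b)) \<le> L"
  shows "d_tau \<tau> b \<le> L"
  unfolding d_tau_eq_SUP(1)
proof (rule cSUP_least)
  note N = nonneg_normal[OF b]
  fix \<epsilon> :: real assume "\<epsilon> \<in> {0<..}"
  then have eps: "\<epsilon> > 0" by simp
  let ?T = "Re (\<tau> (cfc_real b (\<lambda>z. f_eps \<epsilon> (Re z))))"
  have bound: "?T \<le> (1 + 2 * \<kappa> / \<epsilon>) * L" if k: "\<kappa> > 0" for \<kappa>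
  proof -
    have "?T \<le> Re (\<tau> (cfc_real b (\<lambda>z. (1 + 2 * \<kappa> / \<epsilon>) * (Re z / (Re z + \<kappa>)))))"
    proof (intro trace_mono cfc_real_mono N continuous_on_support_approx k continuous_on_mult
        continuous_on_const continuous_on_f_eps eps)
      fix z assume "z \<in> spectrum b"
      then have z: "Re z \<ge> 0" by (rule spectrum_nonneg[OF b])
      show "f_eps \<epsilon> (Re z) \<le> (1 + 2 * \<kappa> / \<epsilon>) * (Re z / (Re z + \<kappa>))"
      proof (cases "Re z \<le> \<epsilon> / 2")
        case True
        then show ?thesis using z k eps by (simp add: f_eps_def)
      next
        case False
        have "\<epsilon> * \<kappa> \<le> (2 * Re z) * \<kappa>" using False k by (intro mult_right_mono) auto
        then have "\<kappa> \<le> 2 * \<kappa> / \<epsilon> * Re z" using eps by (simp add: field_simps)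
        then have "Re z + \<kappa> \<le> (1 + 2 * \<kappa> / \<epsilon>) * Re z" by (simp add: distrib_right)
        moreover have "Re z + \<kappa> > 0" using z k by simp
        ultimately have "1 \<le> (1 + 2 * \<kappa> / \<epsilon>) * (Re z / (Re z + \<kappa>))" by simp
        then show ?thesis using eps by (simp add: f_eps_eq)
      qed
    qed
    also have "\<dots> = (1 + 2 * \<kappa> / \<epsilon>) * Re (\<tau> (support_approx \<kappa> b))"
      unfolding cfc_real_scale[OF N continuous_on_support_approx[OF k]] trace_scaleR
      by (simp add: support_approx_def)
    also have "\<dots> \<le> (1 + 2 * \<kappa> / \<epsilon>) * L" using L[OF k] k eps by (intro mult_left_mono) auto
    finally show ?thesis .
  qed
  have "((\<lambda>\<kappa>. (1 + 2 * \<kappa> / \<epsilon>) * L) \<longlongrightarrow> (1 + 2 * 0 / \<epsilon>) * L) (at_right 0)"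
    using eps by (intro tendsto_intros) auto
  moreover have "\<forall>\<^sub>F \<kappa> in at_right 0. ?T \<le> (1 + 2 * \<kappa> / \<epsilon>) * L"
    unfolding eventually_at_right_field using bound by (intro exI[of _ 1]) auto
  ultimately have "?T \<le> (1 + 2 * 0 / \<epsilon>) * L" by (rule tendsto_lowerbound) simp
  then show "?T \<le> L" by simp
qed auto

end

lemma d_tau_mono:
  assumes "nonneg a" "nonneg (b - a)"
  shows "d_tau \<tau> a \<le> d_tau \<tau> b"
proof (rule d_tau_le[OF assms(1)])
  have b: "nonneg b" using nonneg_add[OF assms] by simp
  fix \<kappa> :: real assume k: "\<kappa> > 0"
  show "Re (\<tau> (support_approx \<kappa> a)) \<le> d_tau \<tau> b"
    using trace_mono[OF support_approx_mono[OF assms k]] d_tau_ge[OF b k] by simp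
qed

lemma d_tau_swap: "d_tau \<tau> (adj X * X) \<le> d_tau \<tau> (X * adj X)"
proof (rule d_tau_le[OF nonneg_adj_mult])
  have nn: "nonneg (X * adj X)" using nonneg_adj_mult[of "adj X"] by simp
  fix \<kappa> :: real assume k: "\<kappa> > 0"
  obtain R where "support_approx \<kappa> (adj X * X) = (R * adj X) * X"
    "support_approx \<kappa> (X * adj X) = X * (R * adj X)" using support_approx_swap[OF k] .
  then show "Re (\<tau> (support_approx \<kappa> (adj X * X))) \<le> d_tau \<tau> (X * adj X)"
    using d_tau_ge[OF nn k] trace_commute[of "R * adj X" X] by simp
qed

lemma d_tau_support:
  assumes x: "normal_element x" and f: "continuous_on (spectrum x) f" and g: "continuous_on (spectrum x) g"
    and nn: "\<And>z. z \<in> spectrum x \<Longrightarrow> 0 \<le> f z \<and> 0 \<le> g z"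
    and supp: "\<And>z. z \<in> spectrum x \<Longrightarrow> 0 < f z \<Longrightarrow> 0 < g z"
  shows "d_tau \<tau> (cfc_real x f) \<le> d_tau \<tau> (cfc_real x g)"
proof (intro d_tau_le cfc_real_nonneg[OF x f])
  fix \<kappa> :: real assume k: "\<kappa> > 0"
  define h where "h z = f z / (f z + \<kappa>)" for z
  have pos: "0 < f z + \<kappa>" if "z \<in> spectrum x" for z using nn[OF that] k by simp
  have h: "continuous_on (spectrum x) h"
    unfolding h_def using f pos by (intro continuous_intros) fastforce+
  have h01: "0 \<le> h z \<and> h z \<le> 1" if "z \<in> spectrum x" for z
    using nn[OF that] k by (simp add: h_def)
  show "Re (\<tau> (support_approx \<kappa> (cfc_real x f))) \<le> d_tau \<tau> (cfc_real x g)"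
  proof (rule field_le_epsilon)
    fix e :: real assume e: "e > 0"
    obtain \<delta> where \<delta>: "\<delta> > 0" "\<forall>z\<in>spectrum x. h z * \<delta> / (g z + \<delta>) \<le> e"
    proof (rule compact_support_bound[OF compact_spectrum_normal[OF x] h g _ _ e])
      show "0 \<le> h z \<and> 0 \<le> g z" if "z \<in> spectrum x" for z using h01 nn that by blast
      show "0 < g z" if "z \<in> spectrum x" "0 < h z" for z
        using that nn[OF that(1)] pos[OF that(1)] supp[OF that(1)] by (auto simp: h_def zero_less_divide_iff)
    qed blast
    have posg: "0 < g z + \<delta>" if "z \<in> spectrum x" for z using nn[OF that] \<delta>(1) by simp
    have gd: "continuous_on (spectrum x) (\<lambda>z. g z / (g z + \<delta>))"
      using g posg by (intro continuous_intros) fastforce+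
    have "Re (\<tau> (support_approx \<kappa> (cfc_real x f))) = Re (\<tau> (cfc_real x h))"
      unfolding h_def using support_approx_cfc_real[OF x f _ k] nn by simp
    also have "\<dots> \<le> Re (\<tau> (cfc_real x (\<lambda>z. g z / (g z + \<delta>) + e)))"
    proof (intro trace_mono cfc_real_mono x h continuous_on_add gd continuous_on_const)
      fix z assume z: "z \<in> spectrum x"
      have "g z / (g z + \<delta>) + \<delta> / (g z + \<delta>) = 1"
        using posg[OF z] by (simp flip: add_divide_distrib)
      then have "h z = h z * (g z / (g z + \<delta>) + \<delta> / (g z + \<delta>))" by simp
      then have "h z = h z * (g z / (g z + \<delta>)) + h z * \<delta> / (g z + \<delta>)"
        by (simp only: distrib_left times_divide_eq_right)
      also have "\<dots> \<le> 1 * (g z / (g z + \<delta>)) + e"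
        using h01[OF z] nn[OF z] \<delta> z by (intro add_mono mult_right_mono) auto
      finally show "h z \<le> g z / (g z + \<delta>) + e" by simp
    qed
    also have "\<dots> = Re (\<tau> (cfc_real x (\<lambda>z. g z / (g z + \<delta>)))) + e"
      unfolding cfc_real_add[OF x gd continuous_on_const] cfc_real_const[OF x]
      by (simp add: trace_add trace_of_real)
    also have "\<dots> = Re (\<tau> (support_approx \<delta> (cfc_real x g))) + e"
      using support_approx_cfc_real[OF x g _ \<delta>(1)] nn by simp
    also have "\<dots> \<le> d_tau \<tau> (cfc_real x g) + e"
      using nn by (intro add_right_mono d_tau_ge cfc_real_nonneg[OF x g] \<delta>(1)) auto
    finally show "Re (\<tau> (support_approx \<kappa> (cfc_real x f))) \<le> d_tau \<tau> (cfc_real x g) + e" .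
  qed
qed (use nn in auto)

end

section \<open>Cuntz comparison\<close>

lemma cuntz_le_iff:
  "a \<lesssim> b \<longleftrightarrow> (\<forall>e>0. \<exists>X. norm (adj X * b * X - (a :: 'a::unital_cstar_algebra)) < e)"
proof
  assume "a \<lesssim> b"
  then obtain X where "(\<lambda>n. adj (X n) * b * X n) \<longlonglongrightarrow> a" by (auto simp: cuntz_le_def)
  then show "\<forall>e>0. \<exists>X. norm (adj X * b * X - a) < e" unfolding LIMSEQ_iff by blast
next
  assume "\<forall>e>0. \<exists>X. norm (adj X * b * X - a) < e"
  then have "\<exists>X. norm (adj X * b * X - a) < 1 / Suc n" for n by simp
  then obtain X where X: "\<And>n. norm (adj (X n) * b * X n - a) < 1 / Suc n" by metis
  have "(\<lambda>n. adj (X n) * b * X n) \<longlonglongrightarrow> a"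
  proof (rule LIM_zero_cancel, rule Lim_null_comparison)
    show "\<forall>\<^sub>F n in sequentially. norm (adj (X n) * b * X n - a) \<le> 1 / real (Suc n)"
      using X by (intro always_eventually allI less_imp_le)
    show "(\<lambda>n. 1 / real (Suc n)) \<longlonglongrightarrow> 0"
      by (rule LIMSEQ_inverse_real_of_nat[unfolded inverse_eq_divide])
  qed
  then show "a \<lesssim> b" unfolding cuntz_le_def by blast
qed

lemma norm_conj_le: "norm (adj X * c * X) \<le> (norm X)\<^sup>2 * norm (c :: 'a::unital_cstar_algebra)"
proof -
  have "norm (adj X * c * X) \<le> norm (adj X * c) * norm X" by (rule norm_mult_ineq)
  also have "\<dots> \<le> (norm X * norm c) * norm X"
    using norm_mult_ineq[of "adj X" c] by (intro mult_right_mono) auto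
  finally show ?thesis by (simp add: power2_eq_square algebra_simps)
qed

lemma cuntz_le_trans [trans]:
  fixes a b c :: "'a::unital_cstar_algebra"
  assumes "a \<lesssim> b" "b \<lesssim> c"
  shows "a \<lesssim> c"
  unfolding cuntz_le_iff
proof (intro allI impI)
  fix e :: real assume e: "e > 0"
  obtain X where X: "norm (adj X * b * X - a) < e / 2"
    using assms(1) e half_gt_zero unfolding cuntz_le_iff by blast
  define \<delta> where "\<delta> = e / 2 / ((norm X)\<^sup>2 + 1)"
  have "\<delta> > 0" using e by (simp add: \<delta>_def add_nonneg_pos)
  then obtain Y where Y: "norm (adj Y * c * Y - b) < \<delta>"
    using assms(2) unfolding cuntz_le_iff by blast
  have "adj (Y * X) * c * (Y * X) - a = adj X * (adj Y * c * Y - b) * X + (adj X * b * X - a)"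
    by (simp add: adj_mult algebra_simps)
  also have "norm \<dots> \<le> norm (adj X * (adj Y * c * Y - b) * X) + norm (adj X * b * X - a)"
    by (rule norm_triangle_ineq)
  also have "\<dots> \<le> (norm X)\<^sup>2 * norm (adj Y * c * Y - b) + norm (adj X * b * X - a)"
    using norm_conj_le by (intro add_right_mono)
  also have "\<dots> \<le> (norm X)\<^sup>2 * \<delta> + norm (adj X * b * X - a)"
    using Y by (intro add_right_mono mult_left_mono) auto
  also have "\<dots> < e / 2 + e / 2"
  proof (rule add_le_less_mono[OF _ X])
    have "(norm X)\<^sup>2 / ((norm X)\<^sup>2 + 1) \<le> 1" by (simp add: add_nonneg_pos)
    then have "(e / 2) * ((norm X)\<^sup>2 / ((norm X)\<^sup>2 + 1)) \<le> (e / 2) * 1" using e by (intro mult_left_mono) auto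
    then show "(norm X)\<^sup>2 * \<delta> \<le> e / 2" by (simp add: \<delta>_def mult.commute)
  qed
  finally show "\<exists>X. norm (adj X * c * X - a) < e" by (intro exI[of _ "Y * X"]) simp
qed

lemma cuntz_le_conj: "adj X * b * X \<lesssim> (b :: 'a::unital_cstar_algebra)"
  unfolding cuntz_le_iff by (metis cancel_comm_monoid_add_class.diff_cancel norm_zero)

text \<open>
  For \<open>Y = (b + \<kappa>)\<^sup>-\<^sup>1\<^sup>/\<^sup>2a\<^sup>1\<^sup>/\<^sup>2\<close> one has \<open>Y\<^sup>*bY = a - \<kappa>Y\<^sup>*Y\<close>, and \<open>a \<le> b\<close> gives \<open>YY\<^sup>* \<le> 1\<close>, so the error is at
  most \<open>\<kappa>\<close>.
\<close>

lemma cuntz_le_mono: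
  fixes a b :: "'a::unital_cstar_algebra"
  assumes a: "nonneg a" and ab: "nonneg (b - a)"
  shows "a \<lesssim> b"
  unfolding cuntz_le_iff
proof (intro allI impI)
  fix e :: real assume e: "e > 0"
  define \<kappa> where "\<kappa> = e / 2"
  have k: "\<kappa> > 0" using e by (simp add: \<kappa>_def)
  have b: "nonneg b" using nonneg_add[OF a ab] by simp
  obtain v where v: "adj v = v" "v * v = a" using nonneg_sqrt[OF a] by metis
  obtain S where S: "adj S = S" "S * b = b * S" "S * S * (b + of_real \<kappa>) = 1"
    using resolvent_root[OF b k] .
  have 1: "S * (b + of_real \<kappa>) * S = 1" by (rule resolvent_root_inverse(2)[OF S(2,3)])
  have SbS: "S * b * S = 1 - \<kappa> *\<^sub>R (S * S)" using 1 by (simp add: algebra_simps scaleR_conv_of_real of_real_central)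
  define Y where "Y = S * v"
  have Yv: "adj Y = v * S" by (simp add: Y_def adj_mult v S)
  have "adj Y * b * Y = v * (S * b * S) * v" unfolding Yv by (simp add: mult.assoc Y_def)
  also have "\<dots> = a - \<kappa> *\<^sub>R (adj Y * Y)"
    unfolding SbS Yv by (simp add: Y_def v(2)[symmetric] algebra_simps)
  finally have eq: "adj Y * b * Y - a = - (\<kappa> *\<^sub>R (adj Y * Y))" by simp
  have YY: "Y * adj Y = S * a * S" unfolding Yv by (simp add: Y_def mult.assoc flip: v(2))
  have "norm (Y * adj Y) \<le> 1"
  proof (rule norm_le_of_nonneg)
    show "nonneg (Y * adj Y)" using nonneg_adj_mult[of "adj Y"] by simp
    have "nonneg (adj S * (b - a) * S + \<kappa> *\<^sub>R (adj S * S))"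
      using k by (intro nonneg_add nonneg_conj ab nonneg_scaleR nonneg_adj_mult) auto
    also have "adj S * (b - a) * S + \<kappa> *\<^sub>R (adj S * S) = S * b * S + \<kappa> *\<^sub>R (S * S) - S * a * S"
      by (simp add: S algebra_simps)
    also have "\<dots> = of_real 1 - Y * adj Y" unfolding SbS YY by simp
    finally show "nonneg (of_real 1 - Y * adj Y)" .
  qed simp
  then have "norm (adj Y * Y) \<le> 1" by (simp add: norm_sq cstar_identity)
  then have "norm (adj Y * b * Y - a) \<le> \<kappa>" using k by (simp add: eq mult_left_le)
  then show "\<exists>X. norm (adj X * b * X - a) < e" using e by (intro exI[of _ Y]) (simp add: \<kappa>_def)
qed

text \<open>
  The element \<open>X = (f/(g + \<delta>))\<^sup>1\<^sup>/\<^sup>2(x)\<close> satisfies \<open>X\<^sup>*g(x)X = (f \<cdot> g/(g + \<delta>))(x)\<close>.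
\<close>

lemma cuntz_le_support:
  fixes x :: "'a::unital_cstar_algebra"
  assumes x: "normal_element x" and f: "continuous_on (spectrum x) f" and g: "continuous_on (spectrum x) g"
    and nn: "\<And>z. z \<in> spectrum x \<Longrightarrow> 0 \<le> f z \<and> 0 \<le> g z"
    and supp: "\<And>z. z \<in> spectrum x \<Longrightarrow> 0 < f z \<Longrightarrow> 0 < g z"
  shows "cfc_real x f \<lesssim> cfc_real x g"
  unfolding cuntz_le_iff
proof (intro allI impI)
  fix e :: real assume e: "e > 0"
  obtain \<delta> where \<delta>: "\<delta> > 0" "\<forall>z\<in>spectrum x. f z * \<delta> / (g z + \<delta>) \<le> e / 2"
    using compact_support_bound[OF compact_spectrum_normal[OF x] f g nn supp half_gt_zero[OF e]] .
  have posg: "0 < g z + \<delta>" if "z \<in> spectrum x" for z using nn[OF that] \<delta>(1) by simp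
  define h where "h z = sqrt (f z / (g z + \<delta>))" for z
  have h: "continuous_on (spectrum x) h"
    unfolding h_def using f g posg by (intro continuous_intros) fastforce+
  have hg: "continuous_on (spectrum x) (\<lambda>z. h z * g z)" "continuous_on (spectrum x) (\<lambda>z. h z * g z * h z)"
    by (intro continuous_on_mult h g)+
  define X where "X = cfc_real x h"
  have "adj X * cfc_real x g * X = cfc_real x h * cfc_real x g * cfc_real x h"
    by (simp add: X_def cfc_real_adj[OF x h])
  also have "\<dots> = cfc_real x (\<lambda>z. h z * g z * h z)"
    by (simp only: cfc_real_mult[OF x h g] cfc_real_mult[OF x hg(1) h])
  finally have "cfc_real x f - adj X * cfc_real x g * X = cfc_real x (\<lambda>z. f z - h z * g z * h z)"
    by (simp only: cfc_real_diff[OF x f hg(2)])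
  also have "norm \<dots> \<le> e / 2"
  proof (intro norm_cfc_real_le x continuous_on_diff f hg(2))
    fix z assume z: "z \<in> spectrum x"
    have "h z * g z * h z = (h z * h z) * g z" by simp
    also have "h z * h z = f z / (g z + \<delta>)" using nn[OF z] \<delta>(1) by (simp add: h_def)
    finally have "f z - h z * g z * h z = f z * \<delta> / (g z + \<delta>)"
      using posg[OF z] by (simp add: field_simps)
    moreover have "0 \<le> f z * \<delta> / (g z + \<delta>)" using nn[OF z] \<delta>(1) by simp
    ultimately show "0 \<le> f z - h z * g z * h z \<and> f z - h z * g z * h z \<le> e / 2" using \<delta>(2) z by simp
  qed (use e in simp)
  finally have "norm (adj X * cfc_real x g * X - cfc_real x f) < e"
    using e by (simp add: norm_minus_commute)
  then show "\<exists>X. norm (adj X * cfc_real x g * X - cfc_real x f) < e" by blast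
qed

section \<open>Comparison of concentric discs\<close>

text \<open>
  With \<open>t = r/s\<close>, expanding \<open>|\<surd>t a - d/\<surd>t|\<^sup>2 \<ge> 0\<close> gives
  \<open>|a + d|\<^sup>2 \<le> (1 + t)|a|\<^sup>2 + (1 + 1/t)|d|\<^sup>2\<close>, and \<open>|d|\<^sup>2 \<le> r\<^sup>2\<close>.  The value of \<open>t\<close> is the one
  for which the constant terms match: \<open>(s + r)\<^sup>2 - (1 + t)s\<^sup>2 = (1 + 1/t)r\<^sup>2\<close>.
\<close>

lemma disc_operator_inequality:
  fixes a d :: "'a::unital_cstar_algebra"
  assumes d: "norm d \<le> r" and r: "r > 0" and s: "s > 0"
  shows "nonneg ((of_real ((s + r)\<^sup>2) - adj (a + d) * (a + d)) - ((s + r) / s) *\<^sub>R (of_real (s\<^sup>2) - adj a * a))"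
proof -
  define t where "t = r / s"
  have t: "t > 0" using r s by (simp add: t_def)
  define Z where "Z = sqrt t *\<^sub>R a - (1 / sqrt t) *\<^sub>R d"
  have ts: "sqrt t * sqrt t = t" "1 / sqrt t * (1 / sqrt t) = 1 / t" "sqrt t * (1 / sqrt t) = 1" "(1 / sqrt t) * sqrt t = 1"
    using t by simp_all
  have expand: "adj (p *\<^sub>R a - q *\<^sub>R d) * (p *\<^sub>R a - q *\<^sub>R d) =
      (p * p) *\<^sub>R (adj a * a) - (p * q) *\<^sub>R (adj a * d) - (q * p) *\<^sub>R (adj d * a) + (q * q) *\<^sub>R (adj d * d)"
    for p q by (simp add: algebra_simps)
  have Z: "adj Z * Z = t *\<^sub>R (adj a * a) - adj a * d - adj d * a + (1 / t) *\<^sub>R (adj d * d)"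
    unfolding Z_def expand ts by simp
  have c: "(s + r) / s = 1 + t" using s by (simp add: t_def field_simps)
  have num: "(s + r)\<^sup>2 - (1 + t) * s\<^sup>2 = (1 + 1 / t) * r\<^sup>2"
    using r s by (simp add: t_def field_simps power2_eq_square)
  have "nonneg (of_real (r\<^sup>2) - adj d * d)"
    using d by (intro nonneg_norm_diff) (simp_all add: adj_mult cstar_identity power_mono)
  then have "nonneg (adj Z * Z + (1 + 1 / t) *\<^sub>R (of_real (r\<^sup>2) - adj d * d))"
    using t by (intro nonneg_add nonneg_adj_mult nonneg_scaleR) auto
  also have "adj Z * Z + (1 + 1 / t) *\<^sub>R (of_real (r\<^sup>2) - adj d * d) =
      of_real ((1 + 1 / t) * r\<^sup>2) + (t *\<^sub>R (adj a * a) - adj a * d - adj d * a - adj d * d)"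
    unfolding Z by (simp add: of_real_def scaleR_add_left scaleR_diff_right)
  also have "\<dots> = (of_real ((s + r)\<^sup>2) - adj (a + d) * (a + d)) - (1 + t) *\<^sub>R (of_real (s\<^sup>2) - adj a * a)"
    unfolding num[symmetric]
    by (simp add: of_real_def scaleR_add_left scaleR_diff_left scaleR_diff_right algebra_simps)
  finally show ?thesis unfolding c .
qed

text \<open>
  The witnesses are \<open>V = w\<phi>(x)\<^sup>1\<^sup>/\<^sup>2\<close> and \<open>X = \<psi>(y)\<^sup>1\<^sup>/\<^sup>2V\<close>, where \<open>\<phi>\<close> and \<open>\<psi>\<close> are the truncated
  quadratic functions of the two discs.  The square in \<open>F\<close> comes from
  \<open>\<phi>(x)\<^sup>1\<^sup>/\<^sup>2(s\<^sup>2 - |x - \<mu>|\<^sup>2)\<phi>(x)\<^sup>1\<^sup>/\<^sup>2 = \<phi>(x)\<^sup>2\<close>: multiplying by \<open>\<phi>(x)\<^sup>1\<^sup>/\<^sup>2\<close> removes the negative part of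
  \<open>s\<^sup>2 - |x - \<mu>|\<^sup>2\<close>, for which the operator inequality gives no information.
\<close>

lemma disc_comparison:
  fixes x y w :: "'a::unital_cstar_algebra" and \<mu> :: complex
  assumes x: "normal_element x" and y: "normal_element y" and w: "unitary_element w"
    and dist: "norm (x - adj w * y * w) \<le> r" and r: "r > 0" and s: "s > 0"
  defines "F \<equiv> cfc_real x (\<lambda>z. ((s + r) / s) * (max 0 (s\<^sup>2 - (cmod (z - \<mu>))\<^sup>2))\<^sup>2)"
    and "G \<equiv> cfc_real y (\<lambda>z. max 0 ((s + r)\<^sup>2 - (cmod (z - \<mu>))\<^sup>2))"
  obtains X V where "adj X * X = adj V * G * V" "nonneg (adj X * X - F)" "nonneg (s\<^sup>2 *\<^sub>R G - X * adj X)"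
proof -
  have ww: "adj w * w = 1" "w * adj w = 1" using w by (auto simp: unitary_element_def)
  define a where "a = x - \<mu> *\<^sub>c 1"
  define k where "k = y - \<mu> *\<^sub>c 1"
  define b where "b = adj w * k * w"
  define d where "d = b - a"
  define \<phi> where "\<phi> z = max 0 (s\<^sup>2 - (cmod (z - \<mu>))\<^sup>2)" for z
  define \<psi> where "\<psi> z = max 0 ((s + r)\<^sup>2 - (cmod (z - \<mu>))\<^sup>2)" for z
  have cont: "continuous_on S \<phi>" "continuous_on S \<psi>" "continuous_on S (\<lambda>z. sqrt (\<phi> z))"
    "continuous_on S (\<lambda>z. sqrt (\<psi> z))" "continuous_on S (\<lambda>z. (cmod (z - \<mu>))\<^sup>2)" for S
    unfolding \<phi>_def \<psi>_def by (intro continuous_intros)+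
  have G: "G = cfc_real y \<psi>" by (simp add: G_def \<psi>_def)
  define e where "e = cfc_real x (\<lambda>z. sqrt (\<phi> z))"
  define H where "H = cfc_real y (\<lambda>z. sqrt (\<psi> z))"
  have sa: "adj e = e" "adj H = H"
    unfolding e_def H_def by (intro cfc_real_adj x y cont)+
  have ee: "e * e = cfc_real x \<phi>"
    unfolding e_def cfc_real_mult[OF x cont(3) cont(3), symmetric]
    by (intro cfc_real_cong x) (simp add: \<phi>_def)
  have HH: "H * H = G"
    unfolding H_def G cfc_real_mult[OF y cont(4) cont(4), symmetric]
    by (intro cfc_real_cong y) (simp add: \<psi>_def)
  have aa: "of_real (R\<^sup>2) - adj (v - \<mu> *\<^sub>c 1) * (v - \<mu> *\<^sub>c 1) = cfc_real v (\<lambda>z. R\<^sup>2 - (cmod (z - \<mu>))\<^sup>2)"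
    if "normal_element v" for v :: 'a and R
    by (simp only: cfc_real_diff[OF that continuous_on_const cont(5)] cfc_real_const[OF that]
        cfc_real_distance_square[OF that])
  have bb: "adj b * b = adj w * (adj k * k) * w"
  proof -
    have "adj b * b = adj w * adj k * (w * adj w) * k * w" by (simp add: b_def adj_mult mult.assoc)
    then show ?thesis by (simp add: ww mult.assoc)
  qed
  have "d = adj w * y * w - x"
    using ww by (simp add: d_def b_def k_def a_def algebra_simps mult_cscale_left mult_cscale_right)
  then have dr: "norm d \<le> r" using dist by (simp add: norm_minus_commute)
  have 1: "nonneg ((of_real ((s + r)\<^sup>2) - adj b * b) - ((s + r) / s) *\<^sub>R (of_real (s\<^sup>2) - adj a * a))"
    using disc_operator_inequality[OF dr r s, of a] by (simp add: d_def)
  have "nonneg (G - (of_real ((s + r)\<^sup>2) - adj k * k))"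
    unfolding k_def aa[OF y] G
    by (intro cfc_real_mono y cont continuous_on_diff continuous_on_const) (simp add: \<psi>_def)
  then have "nonneg (adj w * (G - (of_real ((s + r)\<^sup>2) - adj k * k)) * w)" by (rule nonneg_conj)
  also have "adj w * (G - (of_real ((s + r)\<^sup>2) - adj k * k)) * w = adj w * G * w - (of_real ((s + r)\<^sup>2) - adj b * b)"
  proof -
    have "adj w * of_real ((s + r)\<^sup>2) * w = of_real ((s + r)\<^sup>2)"
      using ww by (simp add: of_real_def)
    then show ?thesis unfolding bb by (simp add: left_diff_distrib right_diff_distrib)
  qed
  finally have "nonneg (adj w * G * w - ((s + r) / s) *\<^sub>R (of_real (s\<^sup>2) - adj a * a))"
    using 1 nonneg_trans by blast
  then have "nonneg (adj e * (adj w * G * w - ((s + r) / s) *\<^sub>R (of_real (s\<^sup>2) - adj a * a)) * e)"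
    by (rule nonneg_conj)
  also have "adj e * (adj w * G * w - ((s + r) / s) *\<^sub>R (of_real (s\<^sup>2) - adj a * a)) * e
      = adj (w * e) * G * (w * e) - ((s + r) / s) *\<^sub>R (e * (of_real (s\<^sup>2) - adj a * a) * e)"
    by (simp only: sa adj_mult left_diff_distrib right_diff_distrib mult_scaleR_left mult_scaleR_right mult.assoc)
  also have "((s + r) / s) *\<^sub>R (e * (of_real (s\<^sup>2) - adj a * a) * e) = F"
  proof -
    have c: "continuous_on (spectrum x) (\<lambda>z. s\<^sup>2 - (cmod (z - \<mu>))\<^sup>2)"
      "continuous_on (spectrum x) (\<lambda>z. sqrt (\<phi> z) * (s\<^sup>2 - (cmod (z - \<mu>))\<^sup>2))"
      "continuous_on (spectrum x) (\<lambda>z. (\<phi> z)\<^sup>2)"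
      by (intro continuous_intros cont)+
    have "e * (of_real (s\<^sup>2) - adj a * a) * e = cfc_real x (\<lambda>z. sqrt (\<phi> z) * (s\<^sup>2 - (cmod (z - \<mu>))\<^sup>2) * sqrt (\<phi> z))"
      unfolding a_def aa[OF x] e_def
      by (simp only: cfc_real_mult[OF x cont(3) c(1)] cfc_real_mult[OF x c(2) cont(3)])
    also have "\<dots> = cfc_real x (\<lambda>z. (\<phi> z)\<^sup>2)"
    proof (intro cfc_real_cong x)
      fix z
      have "sqrt (\<phi> z) * (s\<^sup>2 - (cmod (z - \<mu>))\<^sup>2) * sqrt (\<phi> z) = \<phi> z * (s\<^sup>2 - (cmod (z - \<mu>))\<^sup>2)"
        by (simp add: \<phi>_def)
      also have "\<dots> = (\<phi> z)\<^sup>2" by (simp add: \<phi>_def max_def power2_eq_square)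
      finally show "sqrt (\<phi> z) * (s\<^sup>2 - (cmod (z - \<mu>))\<^sup>2) * sqrt (\<phi> z) = (\<phi> z)\<^sup>2" .
    qed
    finally show ?thesis
      unfolding F_def \<phi>_def[symmetric] cfc_real_scale[OF x c(3)] by simp
  qed
  finally have 2: "nonneg (adj (w * e) * G * (w * e) - F)" .
  define X where "X = H * (w * e)"
  have XX: "adj X * X = adj (w * e) * G * (w * e)"
    by (simp add: X_def adj_mult sa mult.assoc flip: HH)
  have "nonneg (cfc_real x (\<lambda>z. s\<^sup>2) - cfc_real x \<phi>)"
    by (intro cfc_real_mono x cont continuous_on_const) (simp add: \<phi>_def)
  then have "nonneg (of_real (s\<^sup>2) - e * e)" by (simp only: cfc_real_const[OF x] ee)
  then have "nonneg (adj (adj w * H) * (of_real (s\<^sup>2) - e * e) * (adj w * H))" by (rule nonneg_conj)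
  also have "adj (adj w * H) * (of_real (s\<^sup>2) - e * e) * (adj w * H) = s\<^sup>2 *\<^sub>R (H * (w * adj w) * H) - X * adj X"
    by (simp add: X_def adj_mult sa of_real_def left_diff_distrib right_diff_distrib mult.assoc)
  finally have "nonneg (s\<^sup>2 *\<^sub>R G - X * adj X)" by (simp add: ww HH)
  with 2 XX that[of X "w * e"] show thesis by simp
qed

text \<open>
  The functions \<open>\<phi>\<close> and \<open>\<psi>\<close> of the preceding lemma are positive exactly on the two open discs, so
  on the respective spectra they have the same open supports as \<open>f\<close> and \<open>g\<close>.
\<close>

lemma disc_function_comparison:
  fixes x y w :: "'a::unital_cstar_algebra"
  assumes x: "normal_element x" and y: "normal_element y" and w: "unitary_element w"
    and dist: "norm (x - adj w * y * w) \<le> r" and r: "r > 0" and s: "s > 0"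
    and f: "f \<in> disc_functions (spectrum x \<union> spectrum y) (ball \<mu> s)"
    and g: "g \<in> disc_functions (spectrum x \<union> spectrum y) (ball \<mu> (s + r))"
  shows "cfc_real x f \<lesssim> cfc_real y g"
    and "\<tau> \<in> tracial_states \<Longrightarrow> d_tau \<tau> (cfc_real x f) \<le> d_tau \<tau> (cfc_real y g)"
proof -
  define \<phi> where "\<phi> = (\<lambda>z. ((s + r) / s) * (max 0 (s\<^sup>2 - (cmod (z - \<mu>))\<^sup>2))\<^sup>2)"
  define \<psi> where "\<psi> = (\<lambda>z. max 0 ((s + r)\<^sup>2 - (cmod (z - \<mu>))\<^sup>2))"
  obtain X V where XV: "adj X * X = adj V * cfc_real y \<psi> * V" "nonneg (adj X * X - cfc_real x \<phi>)"
    "nonneg (s\<^sup>2 *\<^sub>R cfc_real y \<psi> - X * adj X)"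
    using disc_comparison[OF x y w dist r s, of \<mu>] unfolding \<phi>_def \<psi>_def by blast
  have cont: "continuous_on S \<phi>" "continuous_on S \<psi>" "continuous_on S (\<lambda>z. s\<^sup>2 * \<psi> z)" for S
    unfolding \<phi>_def \<psi>_def by (intro continuous_intros)+
  have nn: "0 \<le> \<phi> z" "0 \<le> \<psi> z" for z using r s by (simp_all add: \<phi>_def \<psi>_def)
  have phi_pos: "0 < \<phi> z" if "z \<in> ball \<mu> s" for z
  proof -
    have "(cmod (z - \<mu>))\<^sup>2 < s\<^sup>2" using that by (intro power_strict_mono) (auto simp: dist_norm norm_minus_commute)
    then have "0 < max 0 (s\<^sup>2 - (cmod (z - \<mu>))\<^sup>2)" by simp
    then have "0 < (max 0 (s\<^sup>2 - (cmod (z - \<mu>))\<^sup>2))\<^sup>2" by (rule zero_less_power)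
    moreover have "0 < (s + r) / s" using r s by simp
    ultimately show ?thesis unfolding \<phi>_def by (intro mult_pos_pos)
  qed
  have psi_pos: "z \<in> ball \<mu> (s + r)" if "0 < \<psi> z" for z
  proof -
    have "(cmod (z - \<mu>))\<^sup>2 < (s + r)\<^sup>2" using that by (simp add: \<psi>_def)
    then have "cmod (z - \<mu>) < s + r" by (rule power2_less_imp_less) (use r s in simp)
    then show ?thesis by (simp add: dist_norm norm_minus_commute)
  qed
  have fc: "continuous_on (spectrum x) f" and gc: "continuous_on (spectrum y) g"
    using f g by (auto simp: disc_functions_def elim: continuous_on_subset)
  have f_phi: "0 \<le> f z" "0 < f z \<Longrightarrow> 0 < \<phi> z" if "z \<in> spectrum x" for z
    using f that phi_pos by (auto simp: disc_functions_def)
  have g_psi: "0 \<le> g z" "0 < \<psi> z \<Longrightarrow> 0 < g z" if "z \<in> spectrum y" for z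
    using g that psi_pos by (auto simp: disc_functions_def)
  have phi_nn: "nonneg (cfc_real x \<phi>)" by (intro cfc_real_nonneg x cont nn)
  have "cfc_real x f \<lesssim> cfc_real x \<phi>"
    using f_phi nn by (intro cuntz_le_support x fc cont) auto
  also have "\<dots> \<lesssim> adj V * cfc_real y \<psi> * V"
    using cuntz_le_mono[OF phi_nn XV(2)] XV(1) by simp
  also have "\<dots> \<lesssim> cfc_real y \<psi>" by (rule cuntz_le_conj)
  also have "\<dots> \<lesssim> cfc_real y g"
    using g_psi nn by (intro cuntz_le_support y gc cont) auto
  finally show "cfc_real x f \<lesssim> cfc_real y g" .
  assume \<tau>: "\<tau> \<in> tracial_states"
  have "d_tau \<tau> (cfc_real x f) \<le> d_tau \<tau> (cfc_real x \<phi>)"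
    using f_phi nn by (intro d_tau_support[OF \<tau>] x fc cont) auto
  also have "\<dots> \<le> d_tau \<tau> (adj X * X)" by (rule d_tau_mono[OF \<tau> phi_nn XV(2)])
  also have "\<dots> \<le> d_tau \<tau> (X * adj X)" by (rule d_tau_swap[OF \<tau>])
  also have "\<dots> \<le> d_tau \<tau> (s\<^sup>2 *\<^sub>R cfc_real y \<psi>)"
    using d_tau_mono[OF \<tau> _ XV(3)] nonneg_adj_mult[of "adj X"] by simp
  also have "s\<^sup>2 *\<^sub>R cfc_real y \<psi> = cfc_real y (\<lambda>z. s\<^sup>2 * \<psi> z)" by (rule cfc_real_scale[OF y cont(2), symmetric])
  also have "d_tau \<tau> \<dots> \<le> d_tau \<tau> (cfc_real y g)"
  proof (intro d_tau_support[OF \<tau>] y gc cont)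
    fix z assume z: "z \<in> spectrum y"
    show "0 \<le> s\<^sup>2 * \<psi> z \<and> 0 \<le> g z" using g_psi[OF z] nn by simp
    show "0 < g z" if "0 < s\<^sup>2 * \<psi> z"
      using that g_psi[OF z] s by (simp add: zero_less_mult_iff)
  qed
  finally show "d_tau \<tau> (cfc_real x f) \<le> d_tau \<tau> (cfc_real y g)" .
qed

section \<open>Unitary orbits\<close>

lemma unitary_orbits_close:
  fixes x y :: "'a::unital_cstar_algebra"
  assumes "setdist (unitary_orbit x) (unitary_orbit y) < r"
  obtains w where "unitary_element w" "norm (x - adj w * y * w) \<le> r"
proof -
  let ?O = "\<lambda>x. {adj u * x * u | u :: 'a. unitary_element u}"
  have one: "unitary_element (1 :: 'a)" by (simp add: unitary_element_def)
  have "setdist (?O x) (?O y) < r" using assms by (simp add: unitary_orbit_def)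
  moreover have "?O x \<noteq> {}" "?O y \<noteq> {}" using one by blast+
  ultimately obtain p q where "p \<in> ?O x" "q \<in> ?O y" "dist p q < r"
    by (rule setdist_ltE)
  then obtain u v where u: "unitary_element u" and v: "unitary_element v"
    and uv: "norm (adj u * x * u - adj v * y * v) < r"
    by (auto simp: dist_norm)
  define w where "w = v * adj u"
  have uu: "u * adj u = 1" "adj u * u = 1" and vv: "v * adj v = 1" "adj v * v = 1"
    using u v by (auto simp: unitary_element_def)
  have "adj w * w = u * (adj v * v) * adj u" "w * adj w = v * (adj u * u) * adj v"
    by (simp_all add: w_def adj_mult mult.assoc)
  then have "unitary_element w" using uu vv by (simp add: unitary_element_def)
  moreover have "norm (x - adj w * y * w) \<le> r"
  proof -
    have "x = (u * adj u) * x * (u * adj u)" by (simp add: uu)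
    then have "x - adj w * y * w = adj (adj u) * (adj u * x * u - adj v * y * v) * adj u"
      by (simp add: w_def adj_mult algebra_simps)
    then have "norm (x - adj w * y * w) \<le> (norm (adj u))\<^sup>2 * norm (adj u * x * u - adj v * y * v)"
      using norm_conj_le by metis
    moreover have "(norm (adj u))\<^sup>2 = 1" using cstar_identity[of u] uu by simp
    ultimately show ?thesis using uv by simp
  qed
  ultimately show thesis using that by blast
qed

lemma delta_le_setdist:
  fixes x y :: "'a::unital_cstar_algebra"
  assumes "normal_element x" "normal_element y"
  shows "delta_T x y \<le> setdist (unitary_orbit x) (unitary_orbit y)"
    and "delta_c x y \<le> setdist (unitary_orbit x) (unitary_orbit y)"
proof -
  let ?D = "setdist (unitary_orbit x) (unitary_orbit y)"
  let ?\<Omega> = "spectrum x \<union> spectrum y"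
  have "delta_T x y \<le> r \<and> delta_c x y \<le> r" if D: "?D < r" for r
  proof
    have r: "r > 0" using setdist_pos_le[of "unitary_orbit x" "unitary_orbit y"] D by linarith
    obtain w where w: "unitary_element w" "norm (x - adj w * y * w) \<le> r"
      using unitary_orbits_close[OF D] .
    note comparison = disc_function_comparison[OF assms w r]
    show "delta_T x y \<le> r" unfolding delta_T_def Let_def
      using comparison(2) r by (intro cInf_lower bdd_belowI[of _ 0]) auto
    show "delta_c x y \<le> r" unfolding delta_c_def Let_def
      using comparison(1) r by (intro cInf_lower bdd_belowI[of _ 0]) auto
  qed
  then show "delta_T x y \<le> ?D" "delta_c x y \<le> ?D" by (auto intro: dense_ge)
qed

text \<open>
  Both distances are maxima of two quantities that differ by exchanging \<open>x\<close> and \<open>y\<close>, and the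
  distance of the orbits is symmetric.
\<close>

theorem theorem8p5:
  fixes x y :: "'a::unital_cstar_algebra"
  assumes "normal_element x" and "normal_element y"
  shows "(separable_algebra TYPE('a) \<and> simple_algebra TYPE('a) \<and> tracial_rank_zero TYPE('a)
            \<longrightarrow> setdist (unitary_orbit x) (unitary_orbit y) \<ge> d_T x y) \<and>
         (finite_dimensional (UNIV :: 'a set)
            \<longrightarrow> setdist (unitary_orbit x) (unitary_orbit y) \<ge> d_c x y)"
  using delta_le_setdist[OF assms] delta_le_setdist[OF assms(2,1)]
  by (simp add: d_T_def d_c_def setdist_sym[of "unitary_orbit y"])

end
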